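(* Let $\Bbbk$ be a field of characteristic different from $2$, $n\ge 1$, and let $E(n)$ be endowed with any quasitriangular structure $R_A$, $A\in M_n(\Bbbk)$. Then an element $\chi\in E(n)\otimes E(n)$ is an infinitesimal $\mathcal{R}$-matrix for $(E(n),R_A)$ if and only if $$\chi=\sum_{p,q=1}^n\gamma_{pq}\,gx_p\otimes x_q$$ for some matrix $\Gamma=(\gamma_{pq})\in M_n(\Bbbk)$; in particular the infinitesimal $\mathcal{R}$-matrices of $(E(n),R_A)$ form an $n^2$-dimensional vector space. Moreover, for such $\chi$, $(E(n),R_A,\chi)$ is Cartier if and only if the associated matrix $\Gamma$ is anti-symmetric, i.e. $\gamma_{pq}=-\gamma_{qp}$ for all $p,q$.
   Context: $E(n)$ is the $2^{n+1}$-dimensional Hopf algebra over $\Bbbk$ generated as an algebra by $g,x_1,\dots,x_n$ with relations $g^2=1$, $x_i^2=0$, $gx_i=-x_ig$, $x_ix_j=-x_jx_i$ for all $i,j$, and with $\Delta(g)=g\otimes g$, $\Delta(x_i)=x_i\otimes 1+g\otimes x_i$, $\varepsilon(g)=1$, $\varepsilon(x_i)=0$, $S(g)=g$, $S(x_i)=-gx_i$. For $P=\{i_1<\dots<i_s\}\subseteq\{1,\dots,n\}$ put $x_P=x_{i_1}\cdots x_{i_s}$, $x_\emptyset=1$. The quasitriangular structures on $E(n)$ are known to be exactly the elements, for $A\in M_n(\Bbbk)$, $$R_A=\tfrac12(1\otimes 1+1\otimes g+g\otimes 1-g\otimes g)+\tfrac12\sum_{|F|=|P|}(-1)^{\frac{|P|(|P|-1)}{2}}\det(P,F)\big(g^{|P|}x_F\otimes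 x_P+g^{|P|}x_F\otimes gx_P+g^{|P|+1}x_F\otimes x_P-g^{|P|+1}x_F\otimes gx_P\big),$$ where $P,F$ run over nonempty subsets of $\{1,\dots,n\}$ with $|F|=|P|$ and $\det(P,F)$ is the determinant of the submatrix of $A$ with rows indexed by $P$ and columns indexed by $F$. For a bialgebra $H$ and $T=\sum_i T^i\otimes T_i\in H\otimes H$ write $T_{12}=T\otimes 1$, $T_{23}=1\otimes T$, $T_{13}=\sum_i T^i\otimes 1\otimes T_i$, $T^{\mathrm{op}}=\sum_i T_i\otimes T^i$. A quasitriangular structure on $H$ is an invertible $\mathcal{R}\in H\otimes H$ with $\Delta^{\mathrm{op}}(h)=\mathcal{R}\Delta(h)\mathcal{R}^{-1}$ for all $h$, $(\mathrm{Id}\otimes\Delta)(\mathcal{R})=\mathcal{R}_{13}\mathcal{R}_{12}$, $(\Delta\otimes\mathrm{Id})(\mathcal{R})=\mathcal{R}_{13}\mathcal{R}_{23}$. An infinitesimal $\mathcal{R}$-matrix for $(H,\mathcal{R})$ is $\chi\in H\otimes H$ such that $\chi\Delta(h)=\Delta(h)\chi$ for all $h\in H$, $(\mathrm{Id}\otimes\Delta)(\chi)=\chi_{12}+\mathcal{R}_{12}^{-1}\chi_{13}\mathcal{R}_{12}$, and $(\Delta\otimes\mathrm{Id})(\chi)=\chi_{23}+\mathcal{R}_{23}^{-1}\chi_{13}\mathcal{R}_{23}$. In this case $(H,\mathcal{R},\chi)$ is Cartier if in addition $\mathcal{R}\chi=\chi^{\mathrm{op}}\mathcal{R}$. *)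

theory Defs
  imports
    "HOL-Library.Poly_Mapping"
    "HOL-Library.Product_Plus"
    "HOL-Analysis.Finite_Cartesian_Product"
    "Jordan_Normal_Form.Determinant"
begin

no_notation vec_index (infixl "$" 100)
no_notation vec_lambda (binder "\<chi>" 10)

section \<open>Two-sided ideals and linear extension\<close>

inductive_set two_sided_ideal :: "'a::ring_1 set \<Rightarrow> 'a set" for S where
  zero: "0 \<in> two_sided_ideal S"
| step: "p \<in> two_sided_ideal S \<Longrightarrow> s \<in> S \<Longrightarrow> p + a * s * b \<in> two_sided_ideal S"

lemma ideal_gen: "s \<in> S \<Longrightarrow> s \<in> two_sided_ideal S"
  using two_sided_ideal.step[OF two_sided_ideal.zero, of s S 1 1] by simp

lemma ideal_add:
  "q \<in> two_sided_ideal S \<Longrightarrow> p \<in> two_sided_ideal S \<Longrightarrow> p + q \<in> two_sided_ideal S"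
  by (induction rule: two_sided_ideal.induct)
     (auto simp: add.assoc[symmetric] intro: two_sided_ideal.step)

lemma ideal_mult_left: "p \<in> two_sided_ideal S \<Longrightarrow> c * p \<in> two_sided_ideal S"
proof (induction rule: two_sided_ideal.induct)
  case (step p s a b)
  then show ?case
    using two_sided_ideal.step[of "c * p" S s "c * a" b] by (simp add: algebra_simps)
qed (simp add: two_sided_ideal.zero)

lemma ideal_mult_right: "p \<in> two_sided_ideal S \<Longrightarrow> p * c \<in> two_sided_ideal S"
proof (induction rule: two_sided_ideal.induct)
  case (step p s a b)
  then show ?case
    using two_sided_ideal.step[of "p * c" S s a "b * c"] by (simp add: algebra_simps)
qed (simp add: two_sided_ideal.zero)

lemma ideal_uminus: "p \<in> two_sided_ideal S \<Longrightarrow> - p \<in> two_sided_ideal S"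
  using ideal_mult_left[of p S "-1"] by simp

lemma ideal_diff:
  "p \<in> two_sided_ideal S \<Longrightarrow> q \<in> two_sided_ideal S \<Longrightarrow> p - q \<in> two_sided_ideal S"
  using ideal_add[OF ideal_uminus[of q S]] by fastforce

lemma ideal_cong_add:
  assumes "p - p' \<in> two_sided_ideal S" "q - q' \<in> two_sided_ideal S"
  shows "(p + q) - (p' + q') \<in> two_sided_ideal S"
  using ideal_add[OF assms] by (simp add: algebra_simps)

lemma ideal_cong_diff:
  assumes "p - p' \<in> two_sided_ideal S" "q - q' \<in> two_sided_ideal S"
  shows "(p - q) - (p' - q') \<in> two_sided_ideal S"
  using ideal_diff[OF assms] by (simp add: algebra_simps)

lemma ideal_cong_uminus:
  assumes "p - p' \<in> two_sided_ideal S"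
  shows "(- p) - (- p') \<in> two_sided_ideal S"
  using ideal_uminus[OF assms] by (simp add: algebra_simps)

lemma ideal_cong_mult:
  assumes "p - p' \<in> two_sided_ideal S" "q - q' \<in> two_sided_ideal S"
  shows "p * q - p' * q' \<in> two_sided_ideal S"
  using ideal_add[OF ideal_mult_left[OF assms(2), of p] ideal_mult_right[OF assms(1), of q']]
  by (simp add: algebra_simps)

lemma ideal_equivp: "equivp (\<lambda>p q. p - q \<in> two_sided_ideal S)"
proof (rule equivpI)
  show "reflp (\<lambda>p q. p - q \<in> two_sided_ideal S)"
    by (simp add: reflp_def two_sided_ideal.zero)
  show "symp (\<lambda>p q. p - q \<in> two_sided_ideal S)"
    by (metis (no_types, lifting) ideal_uminus minus_diff_eq sympI)
  show "transp (\<lambda>p q. p - q \<in> two_sided_ideal S)"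
    by (rule transpI) (metis (no_types, lifting) diff_add_cancel add_diff_eq ideal_add)
qed

lemma poly_mapping_sum_monomials:
  "(\<Sum>m\<in>Poly_Mapping.keys p. Poly_Mapping.single m (Poly_Mapping.lookup p m)) = p"
  by (rule poly_mapping_eqI)
     (auto simp: lookup_sum lookup_single when_def sum.delta in_keys_iff)

definition linear_extension ::
  "('k::zero \<Rightarrow> 'r \<Rightarrow> 'r::comm_monoid_add) \<Rightarrow> ('m \<Rightarrow> 'r) \<Rightarrow> ('m \<Rightarrow>\<^sub>0 'k) \<Rightarrow> 'r" where
  "linear_extension s f p = (\<Sum>m\<in>Poly_Mapping.keys p. s (Poly_Mapping.lookup p m) (f m))"

locale algebra_over = vector_space scale
  for scale :: "'k::field \<Rightarrow> 'r::ring_1 \<Rightarrow> 'r" +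
  assumes scale_mult_left: "scale c u * v = scale c (u * v)"
    and scale_mult_right: "u * scale c v = scale c (u * v)"
begin

lemma linext_superset:
  assumes "finite A" "Poly_Mapping.keys p \<subseteq> A"
  shows "linear_extension scale f p = (\<Sum>m\<in>A. scale (Poly_Mapping.lookup p m) (f m))"
  unfolding linear_extension_def
  by (rule sum.mono_neutral_left) (use assms in \<open>auto simp: in_keys_iff\<close>)

lemma linext_single [simp]: "linear_extension scale f (Poly_Mapping.single m c) = scale c (f m)"
  by (subst linext_superset[of "{m}"]) auto

lemma linext_zero [simp]: "linear_extension scale f 0 = 0"
  by (simp add: linear_extension_def)

lemma linext_add: "linear_extension scale f (p + q) = linear_extension scale f p + linear_extension scale f q"
proof -
  let ?A = "Poly_Mapping.keys p \<union> Poly_Mapping.keys q"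
  have "Poly_Mapping.keys (p + q) \<subseteq> ?A" by (rule keys_add)
  then show ?thesis
    by (simp add: linext_superset[of ?A] lookup_add scale_left_distrib sum.distrib)
qed

lemma linext_uminus: "linear_extension scale f (- p) = - linear_extension scale f p"
proof -
  have "linear_extension scale f (- p) + linear_extension scale f p = 0"
    by (simp flip: linext_add)
  then show ?thesis by (simp add: eq_neg_iff_add_eq_0)
qed

lemma linext_diff: "linear_extension scale f (p - q) = linear_extension scale f p - linear_extension scale f q"
  using linext_add[of f p "- q"] by (simp add: linext_uminus)

lemma linext_sum: "linear_extension scale f (sum h A) = (\<Sum>a\<in>A. linear_extension scale f (h a))"
  by (induction A rule: infinite_finite_induct) (auto simp: linext_add)

lemma linext_mult:
  assumes "\<And>m n. f (m + n) = f m * f n"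
  shows "linear_extension scale f (p * q) = linear_extension scale f p * linear_extension scale f q"
proof -
  have "p * q = (\<Sum>m\<in>Poly_Mapping.keys p. Poly_Mapping.single m (Poly_Mapping.lookup p m)) *
                (\<Sum>n\<in>Poly_Mapping.keys q. Poly_Mapping.single n (Poly_Mapping.lookup q n))"
    by (simp add: poly_mapping_sum_monomials)
  also have "\<dots> = (\<Sum>m\<in>Poly_Mapping.keys p. \<Sum>n\<in>Poly_Mapping.keys q.
      Poly_Mapping.single (m + n) (Poly_Mapping.lookup p m * Poly_Mapping.lookup q n))"
    by (simp add: sum_product mult_single)
  finally have "linear_extension scale f (p * q) =
      (\<Sum>m\<in>Poly_Mapping.keys p. \<Sum>n\<in>Poly_Mapping.keys q. scale (Poly_Mapping.lookup p m * Poly_Mapping.lookup q n) (f (m + n)))"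
    by (simp add: linext_sum)
  also have "\<dots> = linear_extension scale f p * linear_extension scale f q"
    by (simp add: linear_extension_def assms sum_product scale_mult_left scale_mult_right mult.commute)
  finally show ?thesis .
qed

lemma linext_antimult:
  assumes "\<And>m n. f (m + n) = f n * f m"
  shows "linear_extension scale f (p * q) = linear_extension scale f q * linear_extension scale f p"
proof -
  have "p * q = (\<Sum>m\<in>Poly_Mapping.keys p. Poly_Mapping.single m (Poly_Mapping.lookup p m)) *
                (\<Sum>n\<in>Poly_Mapping.keys q. Poly_Mapping.single n (Poly_Mapping.lookup q n))"
    by (simp add: poly_mapping_sum_monomials)
  also have "\<dots> = (\<Sum>m\<in>Poly_Mapping.keys p. \<Sum>n\<in>Poly_Mapping.keys q.
      Poly_Mapping.single (m + n) (Poly_Mapping.lookup p m * Poly_Mapping.lookup q n))"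
    by (simp add: sum_product mult_single)
  finally have "linear_extension scale f (p * q) =
      (\<Sum>m\<in>Poly_Mapping.keys p. \<Sum>n\<in>Poly_Mapping.keys q. scale (Poly_Mapping.lookup p m * Poly_Mapping.lookup q n) (f (m + n)))"
    by (simp add: linext_sum)
  also have "\<dots> = (\<Sum>n\<in>Poly_Mapping.keys q. \<Sum>m\<in>Poly_Mapping.keys p. scale (Poly_Mapping.lookup p m * Poly_Mapping.lookup q n) (f (m + n)))"
    by (rule sum.swap)
  also have "\<dots> = linear_extension scale f q * linear_extension scale f p"
    by (simp add: linear_extension_def assms sum_product scale_mult_left scale_mult_right mult.commute)
  finally show ?thesis .
qed

lemma linext_ideal:
  assumes "\<And>m n. f (m + n) = f m * f n" "\<And>s. s \<in> S \<Longrightarrow> linear_extension scale f s = 0"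
    and "p - q \<in> two_sided_ideal S"
  shows "linear_extension scale f p = linear_extension scale f q"
proof -
  have "linear_extension scale f r = 0" if "r \<in> two_sided_ideal S" for r
    using that by (induction rule: two_sided_ideal.induct)
      (auto simp: linext_add linext_mult[OF assms(1)] assms(2))
  from this[OF assms(3)] show ?thesis by (simp add: linext_diff)
qed

lemma linext_ideal_anti:
  assumes "\<And>m n. f (m + n) = f n * f m" "\<And>s. s \<in> S \<Longrightarrow> linear_extension scale f s = 0"
    and "p - q \<in> two_sided_ideal S"
  shows "linear_extension scale f p = linear_extension scale f q"
proof -
  have "linear_extension scale f r = 0" if "r \<in> two_sided_ideal S" for r
    using that by (induction rule: two_sided_ideal.induct)
      (auto simp: linext_add linext_antimult[OF assms(1)] assms(2))
  from this[OF assms(3)] show ?thesis by (simp add: linext_diff)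
qed

end

interpretation field_alg: algebra_over "(*) :: 'k::field \<Rightarrow> 'k \<Rightarrow> 'k"
  by unfold_locales (auto simp: algebra_simps)

lemma single_zero_central:
  "Poly_Mapping.single 0 c * p = p * Poly_Mapping.single 0 (c::'k::field)"
proof -
  have "Poly_Mapping.single 0 c * (\<Sum>m\<in>Poly_Mapping.keys p. Poly_Mapping.single m (Poly_Mapping.lookup p m)) =
        (\<Sum>m\<in>Poly_Mapping.keys p. Poly_Mapping.single m (Poly_Mapping.lookup p m)) * Poly_Mapping.single 0 c"
    by (simp add: sum_distrib_left sum_distrib_right mult_single mult.commute)
  then show ?thesis by (simp add: poly_mapping_sum_monomials)
qed

lemma mult_single_zero_left:
  "u * (Poly_Mapping.single 0 c * v) = Poly_Mapping.single 0 (c::'k::field) * (u * v)"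
  by (metis mult.assoc single_zero_central)


section \<open>The algebra E(n)\<close>

text \<open>
  The monoid operation that \<^typ>\<open>'m \<Rightarrow>\<^sub>0 'k\<close> convolves along is written additively in the library.
  Hence \<open>'a word\<close>, with concatenation as addition, turns \<open>'a word \<Rightarrow>\<^sub>0 'k\<close> into the free
  \<open>'k\<close>-algebra on \<open>'a\<close>.
\<close>

datatype 'a word = Word (letters: "'a list")

instantiation word :: (type) monoid_add
begin
definition zero_word :: "'a word" where "zero_word = Word []"
definition plus_word :: "'a word \<Rightarrow> 'a word \<Rightarrow> 'a word" where
  "plus_word v w = Word (letters v @ letters w)"
instance by standard (auto simp: zero_word_def plus_word_def)
end

lemma letters_zero [simp]: "letters 0 = []"
  and letters_plus [simp]: "letters (v + w) = letters v @ letters w"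
  by (auto simp: zero_word_def plus_word_def)

text \<open>
  The index set of the generators \<open>x\<^sub>1, \<dots>, x\<^sub>n\<close> is a finite linearly ordered type \<open>'n\<close>,
  so that \<open>n = CARD('n) \<ge> 1\<close>.
\<close>

datatype 'n generator = G | X 'n

abbreviation free_gen :: "'n generator \<Rightarrow> ('n generator word \<Rightarrow>\<^sub>0 'k::field)" where
  "free_gen a \<equiv> Poly_Mapping.single (Word [a]) 1"

definition E_relators :: "('n generator word \<Rightarrow>\<^sub>0 'k::field) set" where
  "E_relators =
     {free_gen G * free_gen G - 1}
     \<union> {free_gen (X i) * free_gen (X i) |i. True}
     \<union> {free_gen G * free_gen (X i) + free_gen (X i) * free_gen G |i. True}
     \<union> {free_gen (X i) * free_gen (X j) + free_gen (X j) * free_gen (X i) |i j. True}"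

quotient_type (overloaded) ('n, 'k) E =
  "'n generator word \<Rightarrow>\<^sub>0 'k::field" / "\<lambda>p q. p - q \<in> two_sided_ideal E_relators"
  by (rule ideal_equivp)

definition word_prod :: "('n generator \<Rightarrow> 'r::monoid_mult) \<Rightarrow> 'n generator word \<Rightarrow> 'r" where
  "word_prod f w = prod_list (map f (letters w))"

lemma word_prod_zero [simp]: "word_prod f 0 = 1"
  and word_prod_plus: "word_prod f (v + w) = word_prod f v * word_prod f w"
  and word_prod_single [simp]: "word_prod f (Word [a]) = f a"
  by (auto simp: word_prod_def)

lemma (in algebra_over) word_prod_E_relators:
  assumes "f G * f G = 1" "\<And>i. f (X i) * f (X i) = 0" "\<And>i. f G * f (X i) = - (f (X i) * f G)"
    and "\<And>i j. f (X i) * f (X j) = - (f (X j) * f (X i))"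
    and "s \<in> E_relators"
  shows "linear_extension scale (word_prod f) s = 0"
proof -
  have one: "linear_extension scale (word_prod f) 1 = 1"
    by (simp flip: single_one)
  show ?thesis
    using assms(5) unfolding E_relators_def
    by (auto simp: linext_add linext_diff linext_mult[OF word_prod_plus] one assms(1-3))
       (metis assms(4) add.left_inverse)
qed

definition counit_gen :: "'n generator \<Rightarrow> 'k::field" where
  "counit_gen a = (case a of G \<Rightarrow> 1 | X i \<Rightarrow> 0)"

lemma counit_respects:
  assumes "p - q \<in> two_sided_ideal E_relators"
  shows "linear_extension (*) (word_prod counit_gen) p =
         linear_extension (*) (word_prod counit_gen) (q :: 'n generator word \<Rightarrow>\<^sub>0 'k::field)"
  by (rule field_alg.linext_ideal[OF word_prod_plus field_alg.word_prod_E_relators assms])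
     (auto simp: counit_gen_def)

instantiation E :: (type, field) ring_1
begin

lift_definition zero_E :: "('a, 'b) E" is 0 .
lift_definition one_E :: "('a, 'b) E" is 1 .
lift_definition plus_E :: "('a, 'b) E \<Rightarrow> ('a, 'b) E \<Rightarrow> ('a, 'b) E" is "(+)"
  by (rule ideal_cong_add)
lift_definition minus_E :: "('a, 'b) E \<Rightarrow> ('a, 'b) E \<Rightarrow> ('a, 'b) E" is "(-)"
  by (rule ideal_cong_diff)
lift_definition uminus_E :: "('a, 'b) E \<Rightarrow> ('a, 'b) E" is uminus
  by (rule ideal_cong_uminus)
lift_definition times_E :: "('a, 'b) E \<Rightarrow> ('a, 'b) E \<Rightarrow> ('a, 'b) E" is "(*)"
  by (rule ideal_cong_mult)

instance
proof
  show "(0 :: ('a, 'b) E) \<noteq> 1"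
  proof
    assume "(0 :: ('a, 'b) E) = 1"
    then have "(0 - 1 :: 'a generator word \<Rightarrow>\<^sub>0 'b) \<in> two_sided_ideal E_relators"
      by transfer
    from counit_respects[OF this] show False
      by (simp flip: single_one)
  qed
qed (transfer, simp add: algebra_simps two_sided_ideal.zero)+

end

lift_definition scaleE :: "'k \<Rightarrow> ('n, 'k::field) E \<Rightarrow> ('n, 'k) E" is
  "\<lambda>c p. Poly_Mapping.single 0 c * p"
  by (metis ideal_mult_left right_diff_distrib)

interpretation E: algebra_over "scaleE :: 'k::field \<Rightarrow> ('n, 'k) E \<Rightarrow> ('n, 'k) E"
proof
  fix c d :: 'k and u v :: "('n, 'k) E"
  show "scaleE c u * v = scaleE c (u * v)"
    by transfer (simp add: mult.assoc two_sided_ideal.zero)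
  show "u * scaleE c v = scaleE c (u * v)"
    by transfer (simp add: mult_single_zero_left two_sided_ideal.zero)
  show "scaleE c (u + v) = scaleE c u + scaleE c v"
    by transfer (simp add: distrib_left two_sided_ideal.zero)
  show "scaleE (c + d) u = scaleE c u + scaleE d u"
    by transfer (simp add: distrib_right single_add two_sided_ideal.zero)
  show "scaleE c (scaleE d u) = scaleE (c * d) u"
    by transfer (simp add: mult_single two_sided_ideal.zero flip: mult.assoc)
  show "scaleE 1 u = u"
    by transfer (simp add: two_sided_ideal.zero)
qed

lift_definition E_gen :: "'n generator \<Rightarrow> ('n, 'k::field) E" is free_gen .

abbreviation gE :: "('n, 'k::field) E" where "gE \<equiv> E_gen G"
abbreviation xE :: "'n \<Rightarrow> ('n, 'k::field) E" where "xE i \<equiv> E_gen (X i)"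

lemma E_relations:
  fixes i j :: 'n
  defines "x \<equiv> xE :: 'n \<Rightarrow> ('n, 'k::field) E"
  shows "gE * gE = (1 :: ('n, 'k) E)" "x i * x i = 0" "gE * x i = - (x i * gE)"
    "x i * x j = - (x j * x i)"
  unfolding x_def
proof -
  note gen = ideal_gen[of _ "E_relators :: ('n generator word \<Rightarrow>\<^sub>0 'k::field) set"]
  show "gE * gE = (1 :: ('n, 'k::field) E)"
    by transfer (rule gen, simp add: E_relators_def)
  show "xE i * xE i = (0 :: ('n, 'k::field) E)"
    by transfer (rule gen, auto simp: E_relators_def)
  show "gE * xE i = - (xE i * gE :: ('n, 'k::field) E)"
    by transfer (unfold diff_minus_eq_add, rule gen, unfold E_relators_def, blast)
  show "xE i * xE j = - (xE j * xE i :: ('n, 'k::field) E)"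
    by transfer (unfold diff_minus_eq_add, rule gen, unfold E_relators_def, blast)
qed


lift_definition counit :: "('n, 'k::field) E \<Rightarrow> 'k" is
  "linear_extension (*) (word_prod counit_gen)"
  by (rule counit_respects)

lemma counit_gen_simps [simp]: "counit gE = 1" "counit (xE i) = 0"
  by (transfer, simp add: counit_gen_def)+

lemma counit_simps [simp]:
  fixes u v :: "('n, 'k::field) E"
  shows "counit (1 :: ('n, 'k) E) = 1" "counit (u + v) = counit u + counit v" "counit (u * v) = counit u * counit v"
  "counit (scaleE c u) = c * counit u"
proof -
  have one: "linear_extension (*) (word_prod counit_gen) 1 = (1 :: 'k)"
    by (simp flip: single_one)
  show "counit (1 :: ('n, 'k) E) = 1" by transfer (rule one)
  show "counit (u + v) = counit u + counit v" by transfer (rule field_alg.linext_add)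
  show "counit (u * v) = counit u * counit v"
    by transfer (rule field_alg.linext_mult[OF word_prod_plus])
  show "counit (scaleE c u) = c * counit u"
    by transfer (simp add: field_alg.linext_mult[OF word_prod_plus])
qed

definition antipode_gen :: "'n generator \<Rightarrow> ('n, 'k::field) E" where
  "antipode_gen a = (case a of G \<Rightarrow> gE | X i \<Rightarrow> - (gE * xE i))"

text \<open>The antipode is the anti-homomorphism extending its values on the generators.\<close>

lift_definition antipode :: "('n, 'k::field) E \<Rightarrow> ('n, 'k) E" is
  "linear_extension scaleE (\<lambda>w. prod_list (rev (map antipode_gen (letters w))))"
proof (rule E.linext_ideal_anti)
  fix s :: "'n generator word \<Rightarrow>\<^sub>0 'k"
  let ?f = "\<lambda>w. prod_list (rev (map antipode_gen (letters w))) :: ('n, 'k) E"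
  let ?L = "linear_extension scaleE ?f"
  have one: "?L 1 = 1" by (simp flip: single_one)
  have anti: "?f (v + w) = ?f w * ?f v" for v w by simp
  have xg: "xE i * gE = - (gE * xE i :: ('n, 'k) E)" for i
    by (simp add: E_relations)
  have 1: "gE * (gE * u) = u" for u :: "('n, 'k) E"
    by (simp add: E_relations flip: mult.assoc)
  have 2: "xE i * (gE * u) = - (gE * (xE i * u))" for i and u :: "('n, 'k) E"
    by (simp add: xg flip: mult.assoc)
  assume "s \<in> E_relators"
  then consider "s = free_gen G * free_gen G - 1"
    | i where "s = free_gen (X i) * free_gen (X i)"
    | i where "s = free_gen G * free_gen (X i) + free_gen (X i) * free_gen G"
    | i j where "s = free_gen (X i) * free_gen (X j) + free_gen (X j) * free_gen (X i)"
    unfolding E_relators_def by blast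
  then show "?L s = 0"
  proof cases
    case (4 i j)
    have "xE i * xE j = - (xE j * xE i :: ('n, 'k) E)" by (rule E_relations)
    then show ?thesis
      by (simp add: 4 E.linext_add E.linext_antimult[OF anti] antipode_gen_def mult.assoc 1 2)
  qed (simp_all add: E.linext_add E.linext_diff E.linext_antimult[OF anti] one
      antipode_gen_def mult.assoc 1 2 xg E_relations(1,2))
qed auto


section \<open>Tensor products\<close>

text \<open>
  Wrapping a multiplicative monoid as an additive one makes
  \<open>'a multiplicative \<times> 'b multiplicative \<Rightarrow>\<^sub>0 'k\<close> the free vector space on \<open>'a \<times> 'b\<close>, with the product
  \<open>(a, b)(a', b') = (aa', bb')\<close> of basis elements. The tensor product is its quotient by the
  multilinearity relators. Multiplying such a relator by a basis element gives a scalar multiple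
  of a relator, so the two-sided ideal they generate is just their linear span.
\<close>

datatype 'a multiplicative = Mult (unMult: 'a)

instantiation multiplicative :: (monoid_mult) monoid_add
begin
definition zero_multiplicative :: "'a multiplicative" where "zero_multiplicative = Mult 1"
definition plus_multiplicative ::
  "'a multiplicative \<Rightarrow> 'a multiplicative \<Rightarrow> 'a multiplicative" where
  "plus_multiplicative a b = Mult (unMult a * unMult b)"
instance
  by standard (auto simp: zero_multiplicative_def plus_multiplicative_def mult.assoc)
end

lemma unMult_zero [simp]: "unMult 0 = 1"
  and unMult_plus [simp]: "unMult (a + b) = unMult a * unMult b"
  by (auto simp: zero_multiplicative_def plus_multiplicative_def)

type_synonym ('n, 'k) E_free2 =
  "('n, 'k) E multiplicative \<times> ('n, 'k) E multiplicative \<Rightarrow>\<^sub>0 'k"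

type_synonym ('n, 'k) E_free3 =
  "('n, 'k) E multiplicative \<times> ('n, 'k) E multiplicative \<times> ('n, 'k) E multiplicative \<Rightarrow>\<^sub>0 'k"

abbreviation free2 :: "'k::field \<Rightarrow> ('n, 'k::field) E \<Rightarrow> ('n, 'k) E \<Rightarrow> ('n, 'k) E_free2" where
  "free2 c a b \<equiv> Poly_Mapping.single (Mult a, Mult b) c"

abbreviation free3 ::
  "'k::field \<Rightarrow> ('n, 'k) E \<Rightarrow> ('n, 'k) E \<Rightarrow> ('n, 'k) E \<Rightarrow> ('n, 'k) E_free3" where
  "free3 c a b d \<equiv> Poly_Mapping.single (Mult a, Mult b, Mult d) c"

definition relators2 :: "('n, 'k::field) E_free2 set" where
  "relators2 =
     {free2 1 (a + a') b - free2 1 a b - free2 1 a' b |a a' b. True}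
     \<union> {free2 1 a (b + b') - free2 1 a b - free2 1 a b' |a b b'. True}
     \<union> {free2 1 (scaleE c a) b - free2 c a b |c a b. True}
     \<union> {free2 1 a (scaleE c b) - free2 c a b |c a b. True}"

definition relators3 :: "('n, 'k::field) E_free3 set" where
  "relators3 =
     {free3 1 (a + a') b d - free3 1 a b d - free3 1 a' b d |a a' b d. True}
     \<union> {free3 1 a (b + b') d - free3 1 a b d - free3 1 a b' d |a b b' d. True}
     \<union> {free3 1 a b (d + d') - free3 1 a b d - free3 1 a b d' |a b d d'. True}
     \<union> {free3 1 (scaleE c a) b d - free3 c a b d |c a b d. True}
     \<union> {free3 1 a (scaleE c b) d - free3 c a b d |c a b d. True}
     \<union> {free3 1 a b (scaleE c d) - free3 c a b d |c a b d. True}"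


definition ext2 ::
  "('k::field \<Rightarrow> 'r \<Rightarrow> 'r::comm_monoid_add) \<Rightarrow> (('n, 'k) E \<Rightarrow> ('n, 'k) E \<Rightarrow> 'r) \<Rightarrow> ('n, 'k) E_free2 \<Rightarrow> 'r"
  where "ext2 s f = linear_extension s (\<lambda>(a, b). f (unMult a) (unMult b))"

definition ext3 ::
  "('k::field \<Rightarrow> 'r \<Rightarrow> 'r::comm_monoid_add) \<Rightarrow> (('n, 'k) E \<Rightarrow> ('n, 'k) E \<Rightarrow> ('n, 'k) E \<Rightarrow> 'r) \<Rightarrow> ('n, 'k) E_free3 \<Rightarrow> 'r"
  where "ext3 s f = linear_extension s (\<lambda>(a, b, d). f (unMult a) (unMult b) (unMult d))"

lemma (in algebra_over) ext2_respects:
  assumes "\<And>a a' b. f (a + a') b = f a b + f a' b" "\<And>a b b'. f a (b + b') = f a b + f a b'"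
    and "\<And>c a b. f (scaleE c a) b = scale c (f a b)" "\<And>c a b. f a (scaleE c b) = scale c (f a b)"
    and "\<And>a a' b b'. f (a * a') (b * b') = f a b * f a' b'"
    and "p - q \<in> two_sided_ideal relators2"
  shows "ext2 scale f p = ext2 scale f q"
  unfolding ext2_def
proof (rule linext_ideal[OF _ _ assms(6)], goal_cases)
  case (2 s)
  then show ?case unfolding relators2_def
    by (auto simp: linext_add linext_diff assms(1-4))
qed (auto simp: assms(5))

lemma (in algebra_over) ext2_simps:
  assumes "\<And>a a' b b'. f (a * a') (b * b') = f a b * f a' b'" "f 1 1 = 1"
  shows "ext2 scale f (p + q) = ext2 scale f p + ext2 scale f q"
    "ext2 scale f (p * q) = ext2 scale f p * ext2 scale f q"
    "ext2 scale f (Poly_Mapping.single 0 c * p) = scale c (ext2 scale f p)"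
    "ext2 scale f 1 = 1"
    "ext2 scale f (free2 1 a b) = f a b"
proof -
  show *: "ext2 scale f (p * q) = ext2 scale f p * ext2 scale f q" for p q
    unfolding ext2_def by (rule linext_mult) (auto simp: assms(1))
  show "ext2 scale f (Poly_Mapping.single 0 c * p) = scale c (ext2 scale f p)"
    by (subst *) (simp add: ext2_def zero_prod_def assms(2) scale_mult_left)
  show "ext2 scale f 1 = 1"
    by (simp add: ext2_def zero_prod_def assms(2) flip: single_one)
qed (simp_all add: ext2_def linext_add)

lemma (in algebra_over) ext3_respects:
  assumes "\<And>a a' b d. f (a + a') b d = f a b d + f a' b d"
    and "\<And>a b b' d. f a (b + b') d = f a b d + f a b' d"
    and "\<And>a b d d'. f a b (d + d') = f a b d + f a b d'"
    and "\<And>c a b d. f (scaleE c a) b d = scale c (f a b d)"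
    and "\<And>c a b d. f a (scaleE c b) d = scale c (f a b d)"
    and "\<And>c a b d. f a b (scaleE c d) = scale c (f a b d)"
    and "\<And>a a' b b' d d'. f (a * a') (b * b') (d * d') = f a b d * f a' b' d'"
    and "p - q \<in> two_sided_ideal relators3"
  shows "ext3 scale f p = ext3 scale f q"
  unfolding ext3_def
proof (rule linext_ideal[OF _ _ assms(8)], goal_cases)
  case (2 s)
  then show ?case unfolding relators3_def
    by (auto simp: linext_add linext_diff assms(1-6))
qed (auto simp: assms(7))

lemma free2_counit_respects:
  fixes p q :: "('n, 'k::field) E_free2"
  assumes "p - q \<in> two_sided_ideal relators2"
  shows "ext2 (*) (\<lambda>a b. counit a * counit b) p = ext2 (*) (\<lambda>a b. counit a * counit b) q"
  by (rule field_alg.ext2_respects[OF _ _ _ _ _ assms])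
     (simp_all only: counit_simps distrib_left distrib_right ac_simps)

lemma free3_counit_respects:
  fixes p q :: "('n, 'k::field) E_free3"
  assumes "p - q \<in> two_sided_ideal relators3"
  shows "ext3 (*) (\<lambda>a b d. counit a * counit b * counit d) p =
         ext3 (*) (\<lambda>a b d. counit a * counit b * counit d) q"
  by (rule field_alg.ext3_respects[OF _ _ _ _ _ _ _ assms])
     (simp_all only: counit_simps distrib_left distrib_right ac_simps)

quotient_type (overloaded) ('n, 'k) EE =
  "('n, 'k::field) E_free2" / "\<lambda>p q. p - q \<in> two_sided_ideal relators2"
  by (rule ideal_equivp)

instantiation EE :: (type, field) ring_1
begin

lift_definition zero_EE :: "('a, 'b) EE" is 0 .
lift_definition one_EE :: "('a, 'b) EE" is 1 .
lift_definition plus_EE :: "('a, 'b) EE \<Rightarrow> ('a, 'b) EE \<Rightarrow> ('a, 'b) EE" is "(+)"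
  by (rule ideal_cong_add)
lift_definition minus_EE :: "('a, 'b) EE \<Rightarrow> ('a, 'b) EE \<Rightarrow> ('a, 'b) EE" is "(-)"
  by (rule ideal_cong_diff)
lift_definition uminus_EE :: "('a, 'b) EE \<Rightarrow> ('a, 'b) EE" is uminus
  by (rule ideal_cong_uminus)
lift_definition times_EE :: "('a, 'b) EE \<Rightarrow> ('a, 'b) EE \<Rightarrow> ('a, 'b) EE" is "(*)"
  by (rule ideal_cong_mult)

instance
proof
  show "(0 :: ('a, 'b) EE) \<noteq> 1"
  proof
    assume "(0 :: ('a, 'b) EE) = 1"
    then have "(0 - 1 :: ('a, 'b) E_free2) \<in> two_sided_ideal relators2"
      by transfer
    from free2_counit_respects[OF this] show False
      by (simp add: ext2_def zero_prod_def flip: single_one)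
  qed
qed (transfer, simp add: algebra_simps two_sided_ideal.zero)+

end

lift_definition scaleEE :: "'k \<Rightarrow> ('n, 'k::field) EE \<Rightarrow> ('n, 'k) EE" is
  "\<lambda>c p. Poly_Mapping.single 0 c * p"
  by (metis ideal_mult_left right_diff_distrib)

interpretation EE: algebra_over "scaleEE :: 'k::field \<Rightarrow> ('n, 'k) EE \<Rightarrow> ('n, 'k) EE"
proof
  fix c d :: 'k and u v :: "('n, 'k) EE"
  show "scaleEE c u * v = scaleEE c (u * v)"
    by transfer (simp add: mult.assoc two_sided_ideal.zero)
  show "u * scaleEE c v = scaleEE c (u * v)"
    by transfer (simp add: mult_single_zero_left two_sided_ideal.zero)
  show "scaleEE c (u + v) = scaleEE c u + scaleEE c v"
    by transfer (simp add: distrib_left two_sided_ideal.zero)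
  show "scaleEE (c + d) u = scaleEE c u + scaleEE d u"
    by transfer (simp add: distrib_right single_add two_sided_ideal.zero)
  show "scaleEE c (scaleEE d u) = scaleEE (c * d) u"
    by transfer (simp add: mult_single two_sided_ideal.zero flip: mult.assoc)
  show "scaleEE 1 u = u"
    by transfer (simp add: two_sided_ideal.zero)
qed

quotient_type (overloaded) ('n, 'k) EEE =
  "('n, 'k::field) E_free3" / "\<lambda>p q. p - q \<in> two_sided_ideal relators3"
  by (rule ideal_equivp)

instantiation EEE :: (type, field) ring_1
begin

lift_definition zero_EEE :: "('a, 'b) EEE" is 0 .
lift_definition one_EEE :: "('a, 'b) EEE" is 1 .
lift_definition plus_EEE :: "('a, 'b) EEE \<Rightarrow> ('a, 'b) EEE \<Rightarrow> ('a, 'b) EEE" is "(+)"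
  by (rule ideal_cong_add)
lift_definition minus_EEE :: "('a, 'b) EEE \<Rightarrow> ('a, 'b) EEE \<Rightarrow> ('a, 'b) EEE" is "(-)"
  by (rule ideal_cong_diff)
lift_definition uminus_EEE :: "('a, 'b) EEE \<Rightarrow> ('a, 'b) EEE" is uminus
  by (rule ideal_cong_uminus)
lift_definition times_EEE :: "('a, 'b) EEE \<Rightarrow> ('a, 'b) EEE \<Rightarrow> ('a, 'b) EEE" is "(*)"
  by (rule ideal_cong_mult)

instance
proof
  show "(0 :: ('a, 'b) EEE) \<noteq> 1"
  proof
    assume "(0 :: ('a, 'b) EEE) = 1"
    then have "(0 - 1 :: ('a, 'b) E_free3) \<in> two_sided_ideal relators3"
      by transfer
    from free3_counit_respects[OF this] show False
      by (simp add: ext3_def zero_prod_def flip: single_one)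
  qed
qed (transfer, simp add: algebra_simps two_sided_ideal.zero)+

end

lift_definition scaleEEE :: "'k \<Rightarrow> ('n, 'k::field) EEE \<Rightarrow> ('n, 'k) EEE" is
  "\<lambda>c p. Poly_Mapping.single 0 c * p"
  by (metis ideal_mult_left right_diff_distrib)

interpretation EEE: algebra_over "scaleEEE :: 'k::field \<Rightarrow> ('n, 'k) EEE \<Rightarrow> ('n, 'k) EEE"
proof
  fix c d :: 'k and u v :: "('n, 'k) EEE"
  show "scaleEEE c u * v = scaleEEE c (u * v)"
    by transfer (simp add: mult.assoc two_sided_ideal.zero)
  show "u * scaleEEE c v = scaleEEE c (u * v)"
    by transfer (simp add: mult_single_zero_left two_sided_ideal.zero)
  show "scaleEEE c (u + v) = scaleEEE c u + scaleEEE c v"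
    by transfer (simp add: distrib_left two_sided_ideal.zero)
  show "scaleEEE (c + d) u = scaleEEE c u + scaleEEE d u"
    by transfer (simp add: distrib_right single_add two_sided_ideal.zero)
  show "scaleEEE c (scaleEEE d u) = scaleEEE (c * d) u"
    by transfer (simp add: mult_single two_sided_ideal.zero flip: mult.assoc)
  show "scaleEEE 1 u = u"
    by transfer (simp add: two_sided_ideal.zero)
qed

definition tensor2 :: "('n, 'k::field) E \<Rightarrow> ('n, 'k) E \<Rightarrow> ('n, 'k) EE" (infix "\<otimes>\<^sub>k" 68) where
  "a \<otimes>\<^sub>k b = abs_EE (free2 1 a b)"

definition tensor3 ::
  "('n, 'k::field) E \<Rightarrow> ('n, 'k) E \<Rightarrow> ('n, 'k) E \<Rightarrow> ('n, 'k) EEE" where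
  "tensor3 a b d = abs_EEE (free3 1 a b d)"

lemma scale_free2: "scaleEE c (a \<otimes>\<^sub>k b) = abs_EE (free2 c a b)"
  by (simp add: tensor2_def scaleEE.abs_eq mult_single)

lemma scale_free3: "scaleEEE c (tensor3 a b d) = abs_EEE (free3 c a b d)"
  by (simp add: tensor3_def scaleEEE.abs_eq mult_single)

lemma tensor2_simps:
  fixes a a' b b' :: "('n, 'k::field) E" and c :: 'k
  shows "(a + a') \<otimes>\<^sub>k b = (a \<otimes>\<^sub>k b) + (a' \<otimes>\<^sub>k b)"
    "a \<otimes>\<^sub>k (b + b') = (a \<otimes>\<^sub>k b) + (a \<otimes>\<^sub>k b')"
    "scaleE c a \<otimes>\<^sub>k b = scaleEE c (a \<otimes>\<^sub>k b)"
    "a \<otimes>\<^sub>k scaleE c b = scaleEE c (a \<otimes>\<^sub>k b)"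
    "(a * a') \<otimes>\<^sub>k (b * b') = (a \<otimes>\<^sub>k b) * (a' \<otimes>\<^sub>k b')"
    "(1 :: ('n, 'k) E) \<otimes>\<^sub>k 1 = 1"
proof -
  have rel: "s - t \<in> relators2 \<Longrightarrow> abs_EE s = abs_EE t" for s t :: "('n, 'k) E_free2"
    by (simp add: EE.abs_eq_iff ideal_gen)
  show "(a + a') \<otimes>\<^sub>k b = (a \<otimes>\<^sub>k b) + (a' \<otimes>\<^sub>k b)"
    unfolding scale_free2 unfolding tensor2_def plus_EE.abs_eq
    by (rule rel, unfold relators2_def diff_diff_eq[symmetric], blast)
  show "a \<otimes>\<^sub>k (b + b') = (a \<otimes>\<^sub>k b) + (a \<otimes>\<^sub>k b')"
    unfolding scale_free2 unfolding tensor2_def plus_EE.abs_eq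
    by (rule rel, unfold relators2_def diff_diff_eq[symmetric], blast)
  show "scaleE c a \<otimes>\<^sub>k b = scaleEE c (a \<otimes>\<^sub>k b)"
    unfolding scale_free2 unfolding tensor2_def plus_EE.abs_eq
    by (rule rel, unfold relators2_def diff_diff_eq[symmetric], blast)
  show "a \<otimes>\<^sub>k scaleE c b = scaleEE c (a \<otimes>\<^sub>k b)"
    unfolding scale_free2 unfolding tensor2_def plus_EE.abs_eq
    by (rule rel, unfold relators2_def diff_diff_eq[symmetric], blast)
  show "(a * a') \<otimes>\<^sub>k (b * b') = (a \<otimes>\<^sub>k b) * (a' \<otimes>\<^sub>k b')"
    by (simp add: tensor2_def times_EE.abs_eq mult_single plus_multiplicative_def)
  show "(1 :: ('n, 'k) E) \<otimes>\<^sub>k 1 = 1"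
    by (simp add: tensor2_def one_EE_def zero_prod_def zero_multiplicative_def flip: single_one)
qed

lemma tensor3_simps:
  fixes a a' b b' d d' :: "('n, 'k::field) E" and c :: 'k
  shows "tensor3 (a + a') b d = tensor3 a b d + tensor3 a' b d"
    "tensor3 a (b + b') d = tensor3 a b d + tensor3 a b' d"
    "tensor3 a b (d + d') = tensor3 a b d + tensor3 a b d'"
    "tensor3 (scaleE c a) b d = scaleEEE c (tensor3 a b d)"
    "tensor3 a (scaleE c b) d = scaleEEE c (tensor3 a b d)"
    "tensor3 a b (scaleE c d) = scaleEEE c (tensor3 a b d)"
    "tensor3 (a * a') (b * b') (d * d') = tensor3 a b d * tensor3 a' b' d'"
    "tensor3 (1 :: ('n, 'k) E) 1 1 = 1"
proof -
  have rel: "s - t \<in> relators3 \<Longrightarrow> abs_EEE s = abs_EEE t" for s t :: "('n, 'k) E_free3"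
    by (simp add: EEE.abs_eq_iff ideal_gen)
  show "tensor3 (a + a') b d = tensor3 a b d + tensor3 a' b d"
    unfolding scale_free3 unfolding tensor3_def plus_EEE.abs_eq
    by (rule rel, unfold relators3_def diff_diff_eq[symmetric] Un_iff mem_Collect_eq simp_thms, metis)
  show "tensor3 a (b + b') d = tensor3 a b d + tensor3 a b' d"
    unfolding scale_free3 unfolding tensor3_def plus_EEE.abs_eq
    by (rule rel, unfold relators3_def diff_diff_eq[symmetric] Un_iff mem_Collect_eq simp_thms, metis)
  show "tensor3 a b (d + d') = tensor3 a b d + tensor3 a b d'"
    unfolding scale_free3 unfolding tensor3_def plus_EEE.abs_eq
    by (rule rel, unfold relators3_def diff_diff_eq[symmetric] Un_iff mem_Collect_eq simp_thms, metis)
  show "tensor3 (scaleE c a) b d = scaleEEE c (tensor3 a b d)"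
    unfolding scale_free3 unfolding tensor3_def plus_EEE.abs_eq
    by (rule rel, unfold relators3_def diff_diff_eq[symmetric] Un_iff mem_Collect_eq simp_thms, metis)
  show "tensor3 a (scaleE c b) d = scaleEEE c (tensor3 a b d)"
    unfolding scale_free3 unfolding tensor3_def plus_EEE.abs_eq
    by (rule rel, unfold relators3_def diff_diff_eq[symmetric] Un_iff mem_Collect_eq simp_thms, metis)
  show "tensor3 a b (scaleE c d) = scaleEEE c (tensor3 a b d)"
    unfolding scale_free3 unfolding tensor3_def plus_EEE.abs_eq
    by (rule rel, unfold relators3_def diff_diff_eq[symmetric] Un_iff mem_Collect_eq simp_thms, metis)
  show "tensor3 (a * a') (b * b') (d * d') = tensor3 a b d * tensor3 a' b' d'"
    by (simp add: tensor3_def times_EEE.abs_eq mult_single plus_multiplicative_def)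
  show "tensor3 (1 :: ('n, 'k) E) 1 1 = 1"
    by (simp add: tensor3_def one_EEE_def zero_prod_def zero_multiplicative_def flip: single_one)
qed

lemma EE_repr:
  "T = (\<Sum>(a, b)\<in>Poly_Mapping.keys (rep_EE T).
          scaleEE (Poly_Mapping.lookup (rep_EE T) (a, b)) (unMult a \<otimes>\<^sub>k unMult b))"
proof -
  have sum: "abs_EE (sum h A) = (\<Sum>a\<in>A. abs_EE (h a))" for h and A :: "'i set"
    by (induction A rule: infinite_finite_induct) (simp_all add: zero_EE_def flip: plus_EE.abs_eq)
  have "T = abs_EE (rep_EE T)"
    by (rule Quotient3_abs_rep[OF Quotient3_EE, symmetric])
  also have "\<dots> = (\<Sum>m\<in>Poly_Mapping.keys (rep_EE T).
      abs_EE (Poly_Mapping.single m (Poly_Mapping.lookup (rep_EE T) m)))"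
    by (subst (1) poly_mapping_sum_monomials[symmetric]) (rule sum)
  finally show ?thesis
    by (simp add: scale_free2 case_prod_unfold)
qed

lemma EE_induct [case_names zero add scale pure]:
  assumes "P 0" "\<And>S T. P S \<Longrightarrow> P T \<Longrightarrow> P (S + T)" "\<And>c T. P T \<Longrightarrow> P (scaleEE c T)"
    and "\<And>a b. P (a \<otimes>\<^sub>k b)"
  shows "P T"
proof -
  have "P (sum h A)" if "\<And>a. P (h a)" for h and A :: "(('a, 'b) E multiplicative \<times> ('a, 'b) E multiplicative) set"
    using that by (induction A rule: infinite_finite_induct) (auto intro: assms)
  then show ?thesis
    by (subst EE_repr) (simp add: assms case_prod_unfold)
qed


section \<open>The bialgebra structure of E(n)\<close>

definition comult_gen :: "'n generator \<Rightarrow> ('n, 'k::field) EE" where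
  "comult_gen a = (case a of G \<Rightarrow> gE \<otimes>\<^sub>k gE | X i \<Rightarrow> (xE i \<otimes>\<^sub>k 1) + (gE \<otimes>\<^sub>k xE i))"

lemma tensor2_zero [simp]: "0 \<otimes>\<^sub>k b = 0" "a \<otimes>\<^sub>k 0 = 0"
  using tensor2_simps(3)[of 0 0 b] tensor2_simps(4)[of a 0 0] by simp_all

lemma tensor2_uminus [simp]: "(- a) \<otimes>\<^sub>k b = - (a \<otimes>\<^sub>k b)" "a \<otimes>\<^sub>k (- b) = - (a \<otimes>\<^sub>k b)"
  using tensor2_simps(3)[of "-1" a b] tensor2_simps(4)[of a "-1" b] by simp_all

lemma comult_gen_relations:
  fixes i j :: 'n
  defines "f \<equiv> comult_gen :: 'n generator \<Rightarrow> ('n, 'k::field) EE"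
  shows "f G * f G = 1" "f (X i) * f (X i) = 0" "f G * f (X i) = - (f (X i) * f G)"
    "f (X i) * f (X j) = - (f (X j) * f (X i))"
proof -
  note m = tensor2_simps(5)[symmetric] and R = E_relations
  show "f G * f G = 1"
    by (simp add: f_def comult_gen_def m R tensor2_simps(6))
  show "f (X i) * f (X i) = 0" and "f G * f (X i) = - (f (X i) * f G)"
    by (simp_all add: f_def comult_gen_def m R distrib_left distrib_right)
  have "(xE i * xE j) \<otimes>\<^sub>k 1 = - ((xE j * xE i) \<otimes>\<^sub>k 1 :: ('n, 'k) EE)"
    "1 \<otimes>\<^sub>k (xE i * xE j) = - (1 \<otimes>\<^sub>k (xE j * xE i) :: ('n, 'k) EE)"
    by (metis R(4) tensor2_uminus(1)) (metis R(4) tensor2_uminus(2))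
  then show "f (X i) * f (X j) = - (f (X j) * f (X i))"
    by (simp add: f_def comult_gen_def m R(1-3) distrib_left distrib_right)
qed

lift_definition comult :: "('n, 'k::field) E \<Rightarrow> ('n, 'k) EE" is
  "linear_extension scaleEE (word_prod comult_gen)"
  by (rule EE.linext_ideal[OF word_prod_plus EE.word_prod_E_relators[OF comult_gen_relations]])

lemma comult_simps:
  fixes u v :: "('n, 'k::field) E"
  shows "comult (u + v) = comult u + comult v" "comult (u * v) = comult u * comult v"
    "comult (scaleE c u) = scaleEE c (comult u)" "comult (1 :: ('n, 'k) E) = 1"
    "comult (gE :: ('n, 'k) E) = gE \<otimes>\<^sub>k gE"
    "comult (xE i :: ('n, 'k) E) = (xE i \<otimes>\<^sub>k 1) + (gE \<otimes>\<^sub>k xE i)"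
proof -
  let ?L = "linear_extension scaleEE (word_prod comult_gen) :: _ \<Rightarrow> ('n, 'k) EE"
  have mult: "?L (p * q) = ?L p * ?L q" for p q
    by (rule EE.linext_mult[OF word_prod_plus])
  show "comult (u + v) = comult u + comult v"
    by transfer (rule EE.linext_add)
  show "comult (u * v) = comult u * comult v"
    by transfer (rule mult)
  show "comult (scaleE c u) = scaleEE c (comult u)"
    by transfer (simp add: mult EE.scale_mult_left)
  show "comult (1 :: ('n, 'k) E) = 1"
    by transfer (simp flip: single_one)
  show "comult (gE :: ('n, 'k) E) = gE \<otimes>\<^sub>k gE"
    by transfer (simp add: comult_gen_def)
  show "comult (xE i :: ('n, 'k) E) = (xE i \<otimes>\<^sub>k 1) + (gE \<otimes>\<^sub>k xE i)"
    by transfer (simp add: comult_gen_def)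
qed

lift_definition flip :: "('n, 'k::field) EE \<Rightarrow> ('n, 'k) EE" is
  "ext2 scaleEE (\<lambda>a b. b \<otimes>\<^sub>k a)"
  by (rule EE.ext2_respects) (auto simp: tensor2_simps)

lift_definition leg12 :: "('n, 'k::field) EE \<Rightarrow> ('n, 'k) EEE" is
  "ext2 scaleEEE (\<lambda>a b. tensor3 a b 1)"
  by (rule EEE.ext2_respects) (auto simp: tensor3_simps simp flip: tensor3_simps(7))

lift_definition leg13 :: "('n, 'k::field) EE \<Rightarrow> ('n, 'k) EEE" is
  "ext2 scaleEEE (\<lambda>a b. tensor3 a 1 b)"
  by (rule EEE.ext2_respects) (auto simp: tensor3_simps simp flip: tensor3_simps(7))

lift_definition leg23 :: "('n, 'k::field) EE \<Rightarrow> ('n, 'k) EEE" is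
  "ext2 scaleEEE (\<lambda>a b. tensor3 1 a b)"
  by (rule EEE.ext2_respects) (auto simp: tensor3_simps simp flip: tensor3_simps(7))

lemma flip_pure: "flip (a \<otimes>\<^sub>k b) = b \<otimes>\<^sub>k a"
  unfolding tensor2_def flip.abs_eq by (simp add: ext2_def tensor2_def)

lemma leg12_simps:
  fixes S T :: "('n, 'k::field) EE"
  shows "leg12 (S + T) = leg12 S + leg12 T" "leg12 (S * T) = leg12 S * leg12 T"
    "leg12 (scaleEE c T) = scaleEEE c (leg12 T)" "leg12 (1 :: ('n, 'k) EE) = 1"
    "leg12 (a \<otimes>\<^sub>k b) = tensor3 a b 1"
proof -
  have t: "tensor3 (a * a') (b * b') 1 = tensor3 a b 1 * tensor3 a' b' 1"
    for a a' b b' :: "('n, 'k) E"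
    using tensor3_simps(7)[where d = 1 and d' = 1] by simp
  show "leg12 (S + T) = leg12 S + leg12 T" by transfer (simp add: ext2_def EEE.linext_add)
  show "leg12 (S * T) = leg12 S * leg12 T"
    by transfer (rule EEE.ext2_simps(2), rule t, rule tensor3_simps)
  show "leg12 (scaleEE c T) = scaleEEE c (leg12 T)"
    by transfer (rule EEE.ext2_simps(3), rule t, rule tensor3_simps)
  show "leg12 (1 :: ('n, 'k) EE) = 1"
    by transfer (simp add: ext2_def zero_prod_def tensor3_simps flip: single_one)
  show "leg12 (a \<otimes>\<^sub>k b) = tensor3 a b 1"
    unfolding tensor2_def leg12.abs_eq by (simp add: ext2_def)
qed

lemma leg23_simps:
  fixes S T :: "('n, 'k::field) EE"
  shows "leg23 (S + T) = leg23 S + leg23 T" "leg23 (S * T) = leg23 S * leg23 T"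
    "leg23 (scaleEE c T) = scaleEEE c (leg23 T)" "leg23 (1 :: ('n, 'k) EE) = 1"
    "leg23 (a \<otimes>\<^sub>k b) = tensor3 1 a b"
proof -
  have t: "tensor3 1 (a * a') (b * b') = tensor3 1 a b * tensor3 1 a' b'"
    for a a' b b' :: "('n, 'k) E"
    using tensor3_simps(7)[where a = 1 and a' = 1] by simp
  show "leg23 (S + T) = leg23 S + leg23 T" by transfer (simp add: ext2_def EEE.linext_add)
  show "leg23 (S * T) = leg23 S * leg23 T"
    by transfer (rule EEE.ext2_simps(2), rule t, rule tensor3_simps)
  show "leg23 (scaleEE c T) = scaleEEE c (leg23 T)"
    by transfer (rule EEE.ext2_simps(3), rule t, rule tensor3_simps)
  show "leg23 (1 :: ('n, 'k) EE) = 1"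
    by transfer (simp add: ext2_def zero_prod_def tensor3_simps flip: single_one)
  show "leg23 (a \<otimes>\<^sub>k b) = tensor3 1 a b"
    unfolding tensor2_def leg23.abs_eq by (simp add: ext2_def)
qed

lemma leg13_pure: "leg13 (a \<otimes>\<^sub>k b) = tensor3 a 1 b"
  unfolding tensor2_def leg13.abs_eq by (simp add: ext2_def)

lemma leg23_commute: "leg23 T * tensor3 a 1 1 = tensor3 a 1 1 * leg23 T"
proof (induction T rule: EE_induct)
  case zero
  have "leg23 (0 :: ('a, 'b) EE) = 0" using leg23_simps(3)[of 0 0] by simp
  then show ?case by simp
qed (simp_all add: leg23_simps algebra_simps EEE.scale_mult_left EEE.scale_mult_right
    flip: tensor3_simps(7))

lemma leg12_commute: "leg12 T * tensor3 1 1 b = tensor3 1 1 b * leg12 T"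
proof (induction T rule: EE_induct)
  case zero
  have "leg12 (0 :: ('a, 'b) EE) = 0" using leg12_simps(3)[of 0 0] by simp
  then show ?case by simp
qed (simp_all add: leg12_simps algebra_simps EEE.scale_mult_left EEE.scale_mult_right
    flip: tensor3_simps(7))

text \<open>
  \<open>a \<otimes> \<Delta>(b)\<close> and \<open>\<Delta>(a) \<otimes> b\<close> are written as the products \<open>(a \<otimes> 1 \<otimes> 1)(1 \<otimes> \<Delta>(b))\<close> and
  \<open>(\<Delta>(a) \<otimes> 1)(1 \<otimes> 1 \<otimes> b)\<close>.
\<close>

lift_definition id_comult :: "('n, 'k::field) EE \<Rightarrow> ('n, 'k) EEE" is
  "ext2 scaleEEE (\<lambda>a b. tensor3 a 1 1 * leg23 (comult b))"
proof (rule EEE.ext2_respects, goal_cases)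
  case (5 p q a a' b b')
  have "tensor3 (a * a') 1 1 = tensor3 a 1 1 * tensor3 a' 1 1"
    using tensor3_simps(7)[of a a' 1 1 1 1] by simp
  then show ?case
    by (simp add: comult_simps leg23_simps mult.assoc)
       (simp add: leg23_commute flip: mult.assoc)
qed (simp_all add: tensor3_simps comult_simps leg23_simps distrib_left distrib_right
    EEE.scale_mult_left EEE.scale_mult_right)

lift_definition comult_id :: "('n, 'k::field) EE \<Rightarrow> ('n, 'k) EEE" is
  "ext2 scaleEEE (\<lambda>a b. leg12 (comult a) * tensor3 1 1 b)"
proof (rule EEE.ext2_respects, goal_cases)
  case (5 p q a a' b b')
  have "tensor3 1 1 (b * b') = tensor3 1 1 b * tensor3 1 1 b'"
    using tensor3_simps(7)[of 1 1 1 1 b b'] by simp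
  moreover have "tensor3 1 1 b * (leg12 (comult a') * c) = leg12 (comult a') * (tensor3 1 1 b * c)" for c
    by (simp add: leg12_commute flip: mult.assoc)
  ultimately show ?case
    by (simp add: comult_simps leg12_simps mult.assoc)
qed (simp_all add: tensor3_simps comult_simps leg12_simps distrib_left distrib_right
    EEE.scale_mult_left EEE.scale_mult_right)


section \<open>Infinitesimal R-matrices\<close>

text \<open>Meaningful for units only; in the definitions below \<open>R\<close> is meant to be invertible.\<close>

definition two_sided_inverse :: "'a::ring_1 \<Rightarrow> 'a" where
  "two_sided_inverse a = (THE b. a * b = 1 \<and> b * a = 1)"

definition infinitesimal_R_matrix :: "('n, 'k::field) EE \<Rightarrow> ('n, 'k) EE \<Rightarrow> bool" where
  "infinitesimal_R_matrix R \<chi> \<longleftrightarrow>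
     (\<forall>h. \<chi> * comult h = comult h * \<chi>) \<and>
     id_comult \<chi> = leg12 \<chi> + two_sided_inverse (leg12 R) * leg13 \<chi> * leg12 R \<and>
     comult_id \<chi> = leg23 \<chi> + two_sided_inverse (leg23 R) * leg13 \<chi> * leg23 R"

definition cartier :: "('n, 'k::field) EE \<Rightarrow> ('n, 'k) EE \<Rightarrow> bool" where
  "cartier R \<chi> \<longleftrightarrow> infinitesimal_R_matrix R \<chi> \<and> R * \<chi> = flip \<chi> * R"


section \<open>The quasitriangular structures \<open>R\<^sub>A\<close>\<close>

definition xE_prod :: "'n::{finite, linorder} set \<Rightarrow> ('n, 'k::field) E" where
  "xE_prod P = prod_list (map xE (sorted_list_of_set P))"

text \<open>Rows are indexed by \<open>P\<close>, columns by \<open>F\<close>, both taken in increasing order.\<close>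

definition minor :: "'k::field ^ 'n::{finite, linorder} ^ 'n::{finite, linorder} \<Rightarrow> 'n set \<Rightarrow> 'n set \<Rightarrow> 'k" where
  "minor A P F = Determinant.det (Matrix.mat (card P) (card F)
     (\<lambda>(i, j). A $ (sorted_list_of_set P ! i) $ (sorted_list_of_set F ! j)))"

definition R_A :: "'k::field ^ 'n::{finite, linorder} ^ 'n::{finite, linorder} \<Rightarrow> ('n, 'k) EE" where
  "R_A A =
     scaleEE (1 / 2) ((1 \<otimes>\<^sub>k 1) + (1 \<otimes>\<^sub>k gE) + (gE \<otimes>\<^sub>k 1) - (gE \<otimes>\<^sub>k gE)) +
     scaleEE (1 / 2) (\<Sum>(P, F) \<in> {(P, F). P \<noteq> {} \<and> F \<noteq> {} \<and> card F = card P}.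
       scaleEE ((- 1) ^ (card P * (card P - 1) div 2) * minor A P F)
         ((gE ^ card P * xE_prod F \<otimes>\<^sub>k xE_prod P) +
          (gE ^ card P * xE_prod F \<otimes>\<^sub>k gE * xE_prod P) +
          (gE ^ (card P + 1) * xE_prod F \<otimes>\<^sub>k xE_prod P) -
          (gE ^ (card P + 1) * xE_prod F \<otimes>\<^sub>k gE * xE_prod P)))"

end

theory Submission
  imports Defs
begin

text \<open>
  Everything is read off from partial evaluations of the two hexagon-type axioms in one tensor factor;
  no basis of \<open>E(n)\<close> is needed. Write \<open>\<epsilon>\<^sub>-\<close> for the character \<open>g \<mapsto> -1\<close>, \<open>x\<^sub>i \<mapsto> 0\<close>, and \<open>\<delta>\<^sub>i\<close> for
  the skew derivation at \<open>\<epsilon>\<close>, \<open>\<epsilon>\<^sub>-\<close> with \<open>\<delta>\<^sub>i(g) = 0\<close>, \<open>\<delta>\<^sub>i(x\<^sub>j) = \<delta>\<^sub>i\<^sub>j\<close>.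
  Since \<open>R = R\<^sub>A = R\<^sub>0(1 + N)\<close> with \<open>N\<close> a combination of commuting square-zero elements
  \<open>g\<^bsup>|P|\<^esup>x\<^sub>F \<otimes> x\<^sub>P\<close>, the element \<open>R\<close> is invertible, and for every \<open>A\<close>
  \<open>(gx\<^sub>p \<otimes> 1)R = R(gx\<^sub>p \<otimes> g)\<close> and \<open>(1 \<otimes> x\<^sub>q)R = R(g \<otimes> x\<^sub>q)\<close>. This gives the axioms for
  \<open>gx\<^sub>p \<otimes> x\<^sub>q\<close>, and \<open>\<chi>\<^sup>o\<^sup>pR = -R\<chi>\<^sup>T\<close> for the transposed matrix, hence the Cartier criterion.

  Conversely, evaluating the axioms at \<open>\<epsilon>\<close> and \<open>\<epsilon>\<^sub>-\<close> kills the slices of \<open>\<chi>\<close> at these characters and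
  shows that the second factor of \<open>\<chi>\<close> lies in the subalgebra generated by the \<open>x\<^sub>i\<close>. Evaluating the
  second axiom at \<open>\<delta>\<^sub>i\<close> then yields \<open>(\<partial>\<^sub>i \<otimes> id)\<chi> = g \<otimes> d\<^sub>i\<close> with \<open>d\<^sub>i = (\<delta>\<^sub>i \<otimes> id)\<chi>\<close> and
  \<open>\<partial>\<^sub>i = (\<delta>\<^sub>i \<otimes> id)\<Delta>\<close>. As \<open>u = \<eta>\<^sub>i(u) + \<partial>\<^sub>i(u)x\<^sub>i\<close>, where \<open>\<eta>\<^sub>i\<close> sets \<open>x\<^sub>i\<close> to \<open>0\<close>, an element killed by
  all \<open>\<partial>\<^sub>i\<close> and both characters vanishes, so \<open>\<chi> = \<Sum>\<^sub>p gx\<^sub>p \<otimes> d\<^sub>p\<close>. The first axiom says that \<open>d\<^sub>p\<close> is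
  skew primitive, and the same argument makes it a combination of the \<open>x\<^sub>q\<close>.
\<close>

section \<open>Multilinear maps out of the tensor powers\<close>

definition bilinear_map ::
  "('k::field \<Rightarrow> 'r \<Rightarrow> 'r::ab_group_add) \<Rightarrow> (('n, 'k) E \<Rightarrow> ('n, 'k) E \<Rightarrow> 'r) \<Rightarrow> bool" where
  "bilinear_map s f \<longleftrightarrow>
     (\<forall>b. Vector_Spaces.linear scaleE s (\<lambda>a. f a b)) \<and> (\<forall>a. Vector_Spaces.linear scaleE s (f a))"

definition trilinear_map ::
  "('k::field \<Rightarrow> 'r \<Rightarrow> 'r::ab_group_add) \<Rightarrow> (('n, 'k) E \<Rightarrow> ('n, 'k) E \<Rightarrow> ('n, 'k) E \<Rightarrow> 'r) \<Rightarrow> bool"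
  where "trilinear_map s f \<longleftrightarrow>
     (\<forall>b d. Vector_Spaces.linear scaleE s (\<lambda>a. f a b d)) \<and>
     (\<forall>a d. Vector_Spaces.linear scaleE s (\<lambda>b. f a b d)) \<and>
     (\<forall>a b. Vector_Spaces.linear scaleE s (\<lambda>d. f a b d))"

text \<open>The lifts through \<open>ext2_respects\<close> are multiplicative, whereas slices at the
  skew derivations \<open>coeff_x i\<close> are only linear. The map is read off on the
  representative \<open>rep_EE T\<close>; by \<open>lift2_abs\<close> the choice of representative
  does not matter once \<open>f\<close> is bilinear.\<close>

definition lift2 ::
  "('k::field \<Rightarrow> 'r \<Rightarrow> 'r::comm_monoid_add) \<Rightarrow> (('n, 'k) E \<Rightarrow> ('n, 'k) E \<Rightarrow> 'r) \<Rightarrow> ('n, 'k) EE \<Rightarrow> 'r"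
  where "lift2 s f T = ext2 s f (rep_EE T)"

definition lift3 ::
  "('k::field \<Rightarrow> 'r \<Rightarrow> 'r::comm_monoid_add) \<Rightarrow> (('n, 'k) E \<Rightarrow> ('n, 'k) E \<Rightarrow> ('n, 'k) E \<Rightarrow> 'r) \<Rightarrow>
     ('n, 'k) EEE \<Rightarrow> 'r"
  where "lift3 s f T = ext3 s f (rep_EEE T)"

lemma (in algebra_over) linear_iffE:
  "Vector_Spaces.linear scaleE scale f \<longleftrightarrow>
     (\<forall>a b. f (a + b) = f a + f b) \<and> (\<forall>c a. f (scaleE c a) = scale c (f a))"
  by (auto simp: Vector_Spaces.linear_iff E.vector_space_axioms vector_space_axioms)

lemma (in algebra_over) linext_scale:
  "linear_extension scale f (Poly_Mapping.single 0 c * p) = scale c (linear_extension scale f p)"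
proof -
  have "Poly_Mapping.single 0 c * p = (\<Sum>m\<in>Poly_Mapping.keys p. Poly_Mapping.single m (c * Poly_Mapping.lookup p m))"
    by (subst poly_mapping_sum_monomials[of p, symmetric]) (simp add: sum_distrib_left mult_single)
  then show ?thesis
    by (simp add: linext_sum scale_sum_right) (simp add: linear_extension_def scale_sum_right)
qed

text \<open>Scalars are central, so expanding \<open>a\<close> and \<open>b\<close> into monomials
  turns \<open>a * s * b\<close> into a combination of generators multiplied by one monomial on each
  side. Only linearity of the extension enters.\<close>

lemma (in algebra_over) linext_vanishes_on_ideal:
  assumes "\<And>a s b. s \<in> S \<Longrightarrow>
    linear_extension scale f (Poly_Mapping.single a 1 * s * Poly_Mapping.single b 1) = 0"
    and "p - q \<in> two_sided_ideal S"
  shows "linear_extension scale f p = linear_extension scale f q"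
proof -
  have mono: "linear_extension scale f (Poly_Mapping.single m c * s * Poly_Mapping.single n d) = 0"
    if "s \<in> S" for m n c d s
  proof -
    have "Poly_Mapping.single m c * s * Poly_Mapping.single n d =
        Poly_Mapping.single 0 (c * d) * (Poly_Mapping.single m 1 * s * Poly_Mapping.single n 1)"
    proof -
      have eqs: "Poly_Mapping.single m c = Poly_Mapping.single 0 c * Poly_Mapping.single m 1"
        "Poly_Mapping.single n d = Poly_Mapping.single 0 d * Poly_Mapping.single n 1"
        "Poly_Mapping.single 0 (c * d) = Poly_Mapping.single 0 c * Poly_Mapping.single 0 d"
        by (simp_all add: mult_single)
      have "Poly_Mapping.single m c * s * Poly_Mapping.single n d = Poly_Mapping.single 0 c *
          ((Poly_Mapping.single m 1 * s) * (Poly_Mapping.single 0 d * Poly_Mapping.single n 1))"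
        by (simp only: eqs(1,2) mult.assoc)
      also have "\<dots> = Poly_Mapping.single 0 c * (Poly_Mapping.single 0 d *
          ((Poly_Mapping.single m 1 * s) * Poly_Mapping.single n 1))"
        by (simp only: mult_single_zero_left[of "Poly_Mapping.single m 1 * s"])
      finally show ?thesis by (simp only: eqs(3) mult.assoc)
    qed
    then show ?thesis by (simp add: linext_scale assms(1)[OF that])
  qed
  have "linear_extension scale f r = 0" if "r \<in> two_sided_ideal S" for r
    using that
  proof (induction rule: two_sided_ideal.induct)
    case (step p s a b)
    have "a * s * b = (\<Sum>m\<in>Poly_Mapping.keys a. Poly_Mapping.single m (Poly_Mapping.lookup a m)) * s *
        (\<Sum>n\<in>Poly_Mapping.keys b. Poly_Mapping.single n (Poly_Mapping.lookup b n))"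
      by (simp add: poly_mapping_sum_monomials)
    also have "linear_extension scale f \<dots> = 0"
      by (simp add: sum_distrib_left sum_distrib_right linext_sum mono[OF step(2)])
    finally show ?case by (simp add: linext_add step)
  qed simp
  from this[OF assms(2)] show ?thesis by (simp add: linext_diff)
qed

text \<open>Multiplying a relator by basis elements on both sides multiplies its tensor factors and
  leaves an expression of the same shape, which every bilinear map kills.\<close>

lemma (in algebra_over) ext2_bilinear_respects:
  assumes "bilinear_map scale f" and "p - q \<in> two_sided_ideal relators2"
  shows "ext2 scale f p = ext2 scale f q"
  unfolding ext2_def
proof (rule linext_vanishes_on_ideal[OF _ assms(2)], goal_cases)
  case (1 a s b)
  let ?f = "\<lambda>(a, b). f (unMult a) (unMult b)"
  have lin: "f (a + a') b = f a b + f a' b" "f a (b + b') = f a b + f a b'"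
    "f (scaleE c a) b = scale c (f a b)" "f a (scaleE c b) = scale c (f a b)" for a a' b b' c
    using assms(1) unfolding bilinear_map_def linear_iffE by blast+
  from 1(1) have "s \<in> relators2" .
  then have "linear_extension scale ?f (Poly_Mapping.single a 1 * s * Poly_Mapping.single b 1) = 0"
    unfolding relators2_def
    apply (elim UnE CollectE exE conjE)
    apply (simp_all only: left_diff_distrib right_diff_distrib mult_single linext_diff linext_single
        plus_prod_def fst_conv snd_conv plus_multiplicative_def unMult_plus mult_1 mult_1_right
        multiplicative.sel prod.case)
    apply (simp_all add: distrib_left distrib_right E.scale_mult_left E.scale_mult_right lin)
    done
  then show ?case .
qed

lemma (in algebra_over) ext3_trilinear_respects:
  assumes "trilinear_map scale f" and "p - q \<in> two_sided_ideal relators3"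
  shows "ext3 scale f p = ext3 scale f q"
  unfolding ext3_def
proof (rule linext_vanishes_on_ideal[OF _ assms(2)], goal_cases)
  case (1 a s b)
  let ?f = "\<lambda>(a, b, d). f (unMult a) (unMult b) (unMult d)"
  have lin: "f (a + a') b d = f a b d + f a' b d" "f a (b + b') d = f a b d + f a b' d"
    "f a b (d + d') = f a b d + f a b d'" "f (scaleE c a) b d = scale c (f a b d)"
    "f a (scaleE c b) d = scale c (f a b d)" "f a b (scaleE c d) = scale c (f a b d)"
    for a a' b b' c d d'
    using assms(1) unfolding trilinear_map_def linear_iffE by blast+
  from 1(1) have "s \<in> relators3" .
  then have "linear_extension scale ?f (Poly_Mapping.single a 1 * s * Poly_Mapping.single b 1) = 0"
    unfolding relators3_def
    apply (elim UnE CollectE exE conjE)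
    apply (simp_all only: left_diff_distrib right_diff_distrib mult_single linext_diff linext_single
        plus_prod_def fst_conv snd_conv plus_multiplicative_def unMult_plus mult_1 mult_1_right
        multiplicative.sel prod.case)
    apply (simp_all add: distrib_left distrib_right E.scale_mult_left E.scale_mult_right lin)
    done
  then show ?case .
qed

lemma rep_abs_EE: "rep_EE (abs_EE p) - p \<in> two_sided_ideal relators2"
  unfolding EE.abs_eq_iff[symmetric] by (rule Quotient3_abs_rep[OF Quotient3_EE])

lemma rep_abs_EEE: "rep_EEE (abs_EEE p) - p \<in> two_sided_ideal relators3"
  unfolding EEE.abs_eq_iff[symmetric] by (rule Quotient3_abs_rep[OF Quotient3_EEE])

context algebra_over begin

lemma lift2_abs: "bilinear_map scale f \<Longrightarrow> lift2 scale f (abs_EE p) = ext2 scale f p"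
  unfolding lift2_def by (rule ext2_bilinear_respects[OF _ rep_abs_EE])

lemma lift3_abs: "trilinear_map scale f \<Longrightarrow> lift3 scale f (abs_EEE p) = ext3 scale f p"
  unfolding lift3_def by (rule ext3_trilinear_respects[OF _ rep_abs_EEE])

lemma lift2_simps:
  assumes "bilinear_map scale f"
  shows "lift2 scale f (a \<otimes>\<^sub>k b) = f a b"
    "lift2 scale f (S + T) = lift2 scale f S + lift2 scale f T"
    "lift2 scale f (scaleEE c T) = scale c (lift2 scale f T)"
proof -
  obtain p q where pq: "S = abs_EE p" "T = abs_EE q"
    by (rule that[OF Quotient3_abs_rep[OF Quotient3_EE, symmetric] Quotient3_abs_rep[OF Quotient3_EE, symmetric]])
  show "lift2 scale f (a \<otimes>\<^sub>k b) = f a b"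
    by (simp add: tensor2_def lift2_abs[OF assms] ext2_def)
  show "lift2 scale f (S + T) = lift2 scale f S + lift2 scale f T"
    unfolding pq plus_EE.abs_eq lift2_abs[OF assms] by (simp add: ext2_def linext_add)
  show "lift2 scale f (scaleEE c T) = scale c (lift2 scale f T)"
    unfolding pq scaleEE.abs_eq lift2_abs[OF assms] by (simp add: ext2_def linext_scale)
qed

lemma lift3_simps:
  assumes "trilinear_map scale f"
  shows "lift3 scale f (tensor3 a b d) = f a b d"
    "lift3 scale f (S + T) = lift3 scale f S + lift3 scale f T"
    "lift3 scale f (scaleEEE c T) = scale c (lift3 scale f T)"
proof -
  obtain p q where pq: "S = abs_EEE p" "T = abs_EEE q"
    by (rule that[OF Quotient3_abs_rep[OF Quotient3_EEE, symmetric] Quotient3_abs_rep[OF Quotient3_EEE, symmetric]])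
  show "lift3 scale f (tensor3 a b d) = f a b d"
    by (simp add: tensor3_def lift3_abs[OF assms] ext3_def)
  show "lift3 scale f (S + T) = lift3 scale f S + lift3 scale f T"
    unfolding pq plus_EEE.abs_eq lift3_abs[OF assms] by (simp add: ext3_def linext_add)
  show "lift3 scale f (scaleEEE c T) = scale c (lift3 scale f T)"
    unfolding pq scaleEEE.abs_eq lift3_abs[OF assms] by (simp add: ext3_def linext_scale)
qed

end

lemma flip_simps:
  "flip (S + T) = flip S + flip T" "flip (scaleEE c T) = scaleEE c (flip T)"
proof -
  show "flip (S + T) = flip S + flip T" by transfer (simp add: ext2_def EE.linext_add)
  show "flip (scaleEE c T) = scaleEE c (flip T)" by transfer (simp add: ext2_def EE.linext_scale)
qed

lemma leg13_simps:
  "leg13 (S + T) = leg13 S + leg13 T" "leg13 (scaleEE c T) = scaleEEE c (leg13 T)"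
proof -
  show "leg13 (S + T) = leg13 S + leg13 T" by transfer (simp add: ext2_def EEE.linext_add)
  show "leg13 (scaleEE c T) = scaleEEE c (leg13 T)" by transfer (simp add: ext2_def EEE.linext_scale)
qed

lemma id_comult_simps:
  "id_comult (S + T) = id_comult S + id_comult T" "id_comult (scaleEE c T) = scaleEEE c (id_comult T)"
  "id_comult (a \<otimes>\<^sub>k b) = tensor3 a 1 1 * leg23 (comult b)"
proof -
  show "id_comult (S + T) = id_comult S + id_comult T" by transfer (simp add: ext2_def EEE.linext_add)
  show "id_comult (scaleEE c T) = scaleEEE c (id_comult T)"
    by transfer (simp add: ext2_def EEE.linext_scale)
  show "id_comult (a \<otimes>\<^sub>k b) = tensor3 a 1 1 * leg23 (comult b)"
    unfolding tensor2_def id_comult.abs_eq by (simp add: ext2_def)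
qed

lemma comult_id_simps:
  "comult_id (S + T) = comult_id S + comult_id T" "comult_id (scaleEE c T) = scaleEEE c (comult_id T)"
  "comult_id (a \<otimes>\<^sub>k b) = leg12 (comult a) * tensor3 1 1 b"
proof -
  show "comult_id (S + T) = comult_id S + comult_id T" by transfer (simp add: ext2_def EEE.linext_add)
  show "comult_id (scaleEE c T) = scaleEEE c (comult_id T)"
    by transfer (simp add: ext2_def EEE.linext_scale)
  show "comult_id (a \<otimes>\<^sub>k b) = leg12 (comult a) * tensor3 1 1 b"
    unfolding tensor2_def comult_id.abs_eq by (simp add: ext2_def)
qed

section \<open>Endomorphisms and skew derivations of \<open>E(n)\<close>\<close>

text \<open>Seeing the projection as the linear extension of evaluation of words gives induction
  over products of generators, and lets the projection itself act as the left factor in the skew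
  Leibniz rule for \<open>partial\<close>.\<close>

lemma abs_E_eq_linext:
  fixes p :: "'n generator word \<Rightarrow>\<^sub>0 'k::field"
  shows "abs_E p = linear_extension scaleE (word_prod E_gen) p"
proof -
  have word: "abs_E (Poly_Mapping.single (Word as) (1 :: 'k)) = word_prod E_gen (Word as)" for as :: "'n generator list"
  proof (induction as)
    case Nil
    then show ?case by (simp add: word_prod_def one_E_def zero_word_def flip: single_one)
  next
    case (Cons a as)
    have "Poly_Mapping.single (Word (a # as)) (1 :: 'k) = free_gen a * Poly_Mapping.single (Word as) 1"
      by (simp add: mult_single plus_word_def)
    then have "abs_E (Poly_Mapping.single (Word (a # as)) 1) = E_gen a * abs_E (Poly_Mapping.single (Word as) (1 :: 'k))"
      by (simp only: E_gen.abs_eq times_E.abs_eq)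
    then show ?case
      by (simp add: Cons word_prod_def)
  qed
  have sum: "abs_E (sum h A) = (\<Sum>a\<in>A. abs_E (h a))" for h and A :: "'i set"
    by (induction A rule: infinite_finite_induct) (simp_all add: zero_E_def flip: plus_E.abs_eq)
  have mono: "abs_E (Poly_Mapping.single m c) = scaleE c (word_prod E_gen m)" for m :: "'n generator word" and c :: 'k
  proof -
    have "abs_E (Poly_Mapping.single m c) = scaleE c (abs_E (Poly_Mapping.single m 1))"
      by (simp add: scaleE.abs_eq mult_single)
    then show ?thesis using word[of "letters m"] by simp
  qed
  have "abs_E p = abs_E (\<Sum>m\<in>Poly_Mapping.keys p. Poly_Mapping.single m (Poly_Mapping.lookup p m))"
    by (simp only: poly_mapping_sum_monomials)
  then show ?thesis
    by (simp only: sum mono linear_extension_def)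
qed

lemma E_induct [case_names one gen add scale]:
  assumes "P 1" "\<And>u a. P u \<Longrightarrow> P (u * E_gen a)" "\<And>u v. P u \<Longrightarrow> P v \<Longrightarrow> P (u + v)"
    "\<And>c u. P u \<Longrightarrow> P (scaleE c u)"
  shows "P u"
proof -
  have word: "P (word_prod E_gen (Word as))" for as
    by (induction as rule: rev_induct) (simp_all add: word_prod_def assms)
  have "P 0" using assms(4)[OF assms(1), of 0] by simp
  then have sum: "P (sum h A)" if "\<And>a. P (h a)" for h and A :: "'a generator word set"
    using that by (induction A rule: infinite_finite_induct) (auto intro: assms)
  have "P (scaleE c (word_prod E_gen m))" for c m
    using word[of "letters m"] by (simp add: assms(4))
  then have "P (abs_E (rep_E u))"
    unfolding abs_E_eq_linext linear_extension_def by (rule sum)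
  then show ?thesis
    by (simp only: Quotient3_abs_rep[OF Quotient3_E])
qed

section \<open>Descent of skew derivations and diagonal endomorphisms to \<open>E(n)\<close>\<close>

lemma (in algebra_over) linext_skew_mult:
  assumes "\<And>m n. f (m + n) = f m * h n + k m * f n"
  shows "linear_extension scale f (p * q) =
    linear_extension scale f p * linear_extension scale h q + linear_extension scale k p * linear_extension scale f q"
proof -
  have "p * q = (\<Sum>m\<in>Poly_Mapping.keys p. Poly_Mapping.single m (Poly_Mapping.lookup p m)) *
                (\<Sum>n\<in>Poly_Mapping.keys q. Poly_Mapping.single n (Poly_Mapping.lookup q n))"
    by (simp add: poly_mapping_sum_monomials)
  also have "\<dots> = (\<Sum>m\<in>Poly_Mapping.keys p. \<Sum>n\<in>Poly_Mapping.keys q.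
      Poly_Mapping.single (m + n) (Poly_Mapping.lookup p m * Poly_Mapping.lookup q n))"
    by (simp add: sum_product mult_single)
  finally have "linear_extension scale f (p * q) =
      (\<Sum>m\<in>Poly_Mapping.keys p. \<Sum>n\<in>Poly_Mapping.keys q. scale (Poly_Mapping.lookup p m * Poly_Mapping.lookup q n) (f (m + n)))"
    by (simp add: linext_sum)
  then show ?thesis
    by (simp add: linear_extension_def assms sum_product scale_mult_left scale_mult_right
        mult.commute scale_right_distrib sum.distrib)
qed

text \<open>With \<open>f\<close>, \<open>h\<close>, \<open>k\<close> also denoting the extensions,
  the image of \<open>a * s * b\<close> is
  \<open>f a * h s * h b + k a * f s * h b + k a * k s * f b\<close>. Hence all three extensions
  have to kill the generators \<open>s\<close>.\<close>

lemma (in algebra_over) linext_skew_ideal: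
  assumes "\<And>m n. f (m + n) = f m * h n + k m * f n"
    and "\<And>m n. h (m + n) = h m * h n" "\<And>m n. k (m + n) = k m * k n"
    and "\<And>s. s \<in> S \<Longrightarrow> linear_extension scale f s = 0 \<and> linear_extension scale h s = 0 \<and> linear_extension scale k s = 0"
    and "p - q \<in> two_sided_ideal S"
  shows "linear_extension scale f p = linear_extension scale f q"
proof -
  have "linear_extension scale f r = 0" if "r \<in> two_sided_ideal S" for r
    using that by (induction rule: two_sided_ideal.induct)
      (simp_all add: linext_add linext_skew_mult[OF assms(1)] linext_mult[OF assms(2)] linext_mult[OF assms(3)] assms(4))
  from this[OF assms(5)] show ?thesis by (simp add: linext_diff)
qed

text \<open>One family covers all algebra endomorphisms in use: the sign changes
  \<open>theta\<close> and \<open>sigma\<close>, and the maps that set some of the \<open>x\<close>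
  generators to zero.\<close>

definition diag_gen :: "bool \<Rightarrow> ('n \<Rightarrow> 'k::field) \<Rightarrow> 'n generator \<Rightarrow> ('n, 'k) E" where
  "diag_gen b t a = (case a of G \<Rightarrow> if b then gE else - gE | X i \<Rightarrow> scaleE (t i) (xE i))"

lemma diag_gen_relators:
  fixes t :: "'n \<Rightarrow> 'k::field"
  assumes "s \<in> E_relators"
  shows "linear_extension scaleE (word_prod (diag_gen b t)) s = 0"
proof (rule E.word_prod_E_relators[OF _ _ _ _ assms])
  fix i j :: 'n
  have x: "xE i * xE j = - (xE j * xE i :: ('n, 'k) E)" by (rule E_relations)
  show "diag_gen b t (X i) * diag_gen b t (X j) = - (diag_gen b t (X j) * diag_gen b t (X i))"
    using x by (simp add: diag_gen_def E.scale_mult_left E.scale_mult_right mult.commute)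
qed (simp_all add: diag_gen_def E.scale_mult_left E.scale_mult_right E_relations)

lift_definition diag :: "bool \<Rightarrow> ('n \<Rightarrow> 'k) \<Rightarrow> ('n, 'k::field) E \<Rightarrow> ('n, 'k) E" is
  "\<lambda>b t. linear_extension scaleE (word_prod (diag_gen b t))"
  by (rule E.linext_ideal[OF word_prod_plus diag_gen_relators])

lemma diag_simps [simp]:
  fixes u v :: "('n, 'k::field) E"
  shows
  "diag b t (u + v) = diag b t u + diag b t v"
  "diag b t (u * v) = diag b t u * diag b t v"
  "diag b t (scaleE c u) = scaleE c (diag b t u)"
  "diag b t (1 :: ('n, 'k) E) = 1"
  "diag b t gE = (if b then gE else - gE)"
  "diag b t (xE i) = scaleE (t i) (xE i)"
proof -
  show "diag b t (u + v) = diag b t u + diag b t v"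
    by transfer (rule E.linext_add)
  show "diag b t (u * v) = diag b t u * diag b t v"
    by transfer (rule E.linext_mult[OF word_prod_plus])
  show "diag b t (scaleE c u) = scaleE c (diag b t u)"
    by transfer (rule E.linext_scale)
  show "diag b t (1 :: ('n, 'k) E) = 1"
    by transfer (simp flip: single_one)
  show "diag b t gE = (if b then gE else - gE)" "diag b t (xE i) = scaleE (t i) (xE i)"
    by (simp_all add: E_gen.abs_eq diag.abs_eq diag_gen_def)
qed

text \<open>These are the two contractions of the coproduct with the character
  \<open>counit_minus\<close>: in the first factor it gives \<open>theta\<close>, in the second
  \<open>sigma\<close>; see \<open>slice_comult\<close>.\<close>

abbreviation theta :: "('n, 'k::field) E \<Rightarrow> ('n, 'k) E" where "theta \<equiv> diag False (\<lambda>_. - 1)"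
abbreviation sigma :: "('n, 'k::field) E \<Rightarrow> ('n, 'k) E" where "sigma \<equiv> diag False (\<lambda>_. 1)"

text \<open>The recursion is the Leibniz rule with \<open>theta\<close> on the right: the letter
  \<open>X i\<close> is removed and \<open>theta\<close> is applied to all letters after it.\<close>

fun partial_word :: "'n \<Rightarrow> 'n generator list \<Rightarrow> ('n, 'k::field) E" where
  "partial_word i [] = 0"
| "partial_word i (a # w) =
     (if a = X i then word_prod (diag_gen False (\<lambda>_. - 1)) (Word w) else 0) + E_gen a * partial_word i w"

lemma partial_word_plus:
  "partial_word i (letters (v + w)) =
     partial_word i (letters v) * word_prod (diag_gen False (\<lambda>_. - 1)) w + word_prod E_gen v * partial_word i (letters w)"
proof -
  have "partial_word i (as @ bs) = partial_word i as * word_prod (diag_gen False (\<lambda>_. - 1)) (Word bs)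
      + word_prod E_gen (Word as) * partial_word i bs" for as bs
    by (induction as) (auto simp: word_prod_def algebra_simps)
  from this[of "letters v" "letters w"] show ?thesis by simp
qed

lemma partial_word_relators:
  assumes "s \<in> E_relators"
  shows "linear_extension scaleE (\<lambda>w. partial_word i (letters w)) s = 0"
proof -
  have one: "Poly_Mapping.single 0 c = Poly_Mapping.single (Word []) c" for c :: 'b
    by (simp add: zero_word_def)
  show ?thesis
    using assms unfolding E_relators_def
    by (auto simp: E.linext_add E.linext_diff mult_single plus_word_def one word_prod_def diag_gen_def
        E_relations(3) simp flip: single_one)
qed

lemma partial_respects:
  fixes p q :: "'n generator word \<Rightarrow>\<^sub>0 'k::field"
  assumes "p - q \<in> two_sided_ideal E_relators"
  shows "linear_extension scaleE (\<lambda>w. partial_word i (letters w)) p =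
    linear_extension scaleE (\<lambda>w. partial_word i (letters w)) q"
proof (rule E.linext_skew_ideal[OF partial_word_plus word_prod_plus word_prod_plus _ assms])
  fix s :: "'n generator word \<Rightarrow>\<^sub>0 'k"
  assume s: "s \<in> E_relators"
  \<comment> \<open>The left multiplier in the Leibniz rule is the projection to
    \<open>E(n)\<close>, which kills the relators by construction.\<close>
  then have "abs_E s = 0"
    by (simp add: zero_E_def E.abs_eq_iff ideal_gen)
  with s show "linear_extension scaleE (\<lambda>w. partial_word i (letters w)) s = 0 \<and>
      linear_extension scaleE (word_prod (diag_gen False (\<lambda>_. - 1))) s = 0 \<and>
      linear_extension scaleE (word_prod E_gen) s = 0"
    by (simp add: partial_word_relators diag_gen_relators abs_E_eq_linext)
qed

text \<open>
  The skew derivation \<open>(\<delta>\<^sub>i \<otimes> id)\<Delta>\<close>, where \<open>\<delta>\<^sub>i\<close> takes the coefficients of \<open>x\<^sub>i\<close> and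
  \<open>gx\<^sub>i\<close> and adds them up.
\<close>

lift_definition partial :: "'n \<Rightarrow> ('n, 'k::field) E \<Rightarrow> ('n, 'k) E" is
  "\<lambda>i. linear_extension scaleE (\<lambda>w. partial_word i (letters w))"
  by (rule partial_respects)

lemma partial_simps [simp]:
  fixes u v :: "('n, 'k::field) E"
  shows
  "partial i (u + v) = partial i u + partial i v"
  "partial i (scaleE c u) = scaleE c (partial i u)"
  "partial i (u * v) = partial i u * theta v + u * partial i v"
  "partial i (1 :: ('n, 'k) E) = 0" "partial i (gE :: ('n, 'k) E) = 0"
  "partial i (xE j :: ('n, 'k) E) = (if i = j then 1 else 0)"
proof -
  show "partial i (u + v) = partial i u + partial i v"
    by transfer (rule E.linext_add)
  show "partial i (scaleE c u) = scaleE c (partial i u)"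
    by transfer (rule E.linext_scale)
  have "partial i (abs_E p * abs_E q) = partial i (abs_E p) * theta (abs_E q) + abs_E p * partial i (abs_E q)"
    for p q :: "'n generator word \<Rightarrow>\<^sub>0 'k"
    unfolding times_E.abs_eq partial.abs_eq diag.abs_eq E.linext_skew_mult[OF partial_word_plus]
    by (simp only: abs_E_eq_linext)
  from this[of "rep_E u" "rep_E v"]
  show "partial i (u * v) = partial i u * theta v + u * partial i v"
    by (simp only: Quotient3_abs_rep[OF Quotient3_E])
  show "partial i (1 :: ('n, 'k) E) = 0"
    by transfer (simp flip: single_one)
  show "partial i (gE :: ('n, 'k) E) = 0"
    by transfer simp
  show "partial i (xE j :: ('n, 'k) E) = (if i = j then 1 else 0)"
    by transfer (auto simp: zero_word_def[symmetric])
qed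

text \<open>Moving a generator to the left past the final \<open>xE i\<close> costs a sign, and this
  is the sign that \<open>theta\<close> puts on the generator in the Leibniz rule. So the
  decomposition survives right multiplication by each generator.\<close>

lemma partial_decomposition:
  "u = diag True (\<lambda>j. if j = i then 0 else 1) u + partial i u * xE i"
proof (induction u rule: E_induct)
  case (gen u a)
  let ?e = "diag True (\<lambda>j. if j = i then 0 else 1) :: ('a, 'b) E \<Rightarrow> _"
  show ?case
  proof (cases a)
    case G
    have "u * gE = ?e u * gE + partial i u * (xE i * gE)"
      using arg_cong[OF gen, of "\<lambda>v. v * gE"] by (simp only: distrib_right mult.assoc)
    also have "\<dots> = ?e (u * gE) + partial i (u * gE) * xE i"
      by (simp add: E_relations(3) mult.assoc)
    finally show ?thesis by (simp only: G)
  next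
    case (X j)
    have "u * xE j = ?e u * xE j + partial i u * (xE i * xE j)"
      using arg_cong[OF gen, of "\<lambda>v. v * xE j"] by (simp only: distrib_right mult.assoc)
    also have "partial i u * (xE i * xE j) = - partial i u * (xE j * xE i)"
      by (subst E_relations(4)) simp
    also have "?e u * xE j + - partial i u * (xE j * xE i) = ?e (u * xE j) + partial i (u * xE j) * xE i"
    proof (cases "j = i")
      \<comment> \<open>For \<open>j = i\<close> the second summand ends in the square of
        \<open>xE i\<close>, so multiplying the induction hypothesis by \<open>xE i\<close> leaves
        only the part without \<open>xE i\<close>.\<close>
      case True
      with calculation have "?e u * xE j = u * xE j"
        by (simp add: E_relations(2))
      with True show ?thesis
        by (simp add: left_diff_distrib distrib_right mult.assoc E_relations(2))
    qed (simp add: mult.assoc)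
    finally show ?thesis by (simp only: X)
  qed
next
  case (add u v)
  let ?e = "diag True (\<lambda>j. if j = i then 0 else 1) :: ('a, 'b) E \<Rightarrow> _"
  have "u + v = (?e u + partial i u * xE i) + (?e v + partial i v * xE i)"
    by (rule arg_cong2[OF add])
  also have "\<dots> = ?e (u + v) + partial i (u + v) * xE i"
    by (simp add: distrib_right)
  finally show ?case .
next
  case (scale c u)
  let ?e = "diag True (\<lambda>j. if j = i then 0 else 1) :: ('a, 'b) E \<Rightarrow> _"
  have "scaleE c u = scaleE c (?e u + partial i u * xE i)"
    by (rule arg_cong[OF scale])
  also have "\<dots> = ?e (scaleE c u) + partial i (scaleE c u) * xE i"
    by (simp add: E.scale_right_distrib E.scale_mult_left)
  finally show ?case .
qed simp

definition counit_minus :: "('n, 'k::field) E \<Rightarrow> 'k" where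
  "counit_minus u = counit (sigma u)"

definition coeff_x :: "'n \<Rightarrow> ('n, 'k::field) E \<Rightarrow> 'k" where
  "coeff_x i u = counit (partial i u)"

lemma counit_uminus [simp]: "counit (- u) = - counit u" "counit 0 = 0"
  using counit_simps(4)[of "-1" u] counit_simps(4)[of 0 0] by simp_all

lemma counit_minus_simps [simp]:
  "counit_minus (1 :: ('n, 'k::field) E) = 1" "counit_minus (u + v) = counit_minus u + counit_minus v"
  "counit_minus (u * v) = counit_minus u * counit_minus v" "counit_minus (scaleE c u) = c * counit_minus u"
  "counit_minus gE = - 1" "counit_minus (xE i) = 0"
  by (simp_all add: counit_minus_def)

lemma uminus_simps [simp]:
  "counit_minus (- u) = - counit_minus u" "diag b t (- u) = - diag b t u" "partial i (- u) = - partial i u"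
  using counit_minus_simps(4)[of "- 1" u] diag_simps(3)[of b t "- 1" u] partial_simps(2)[of i "- 1" u]
  by simp_all

lemma counit_diag [simp]: "counit (diag b t u) = (if b then counit u else counit_minus u)"
proof (induction u rule: E_induct)
  case (gen u a)
  then show ?case by (cases a) auto
qed auto

lemma counit_minus_theta [simp]: "counit_minus (theta u) = counit u"
proof (induction u rule: E_induct)
  case (gen u a)
  then show ?case by (cases a) auto
qed auto

lemma counit_minus_sigma [simp]: "counit_minus (sigma u) = counit u"
proof (induction u rule: E_induct)
  case (gen u a)
  then show ?case by (cases a) auto
qed auto

lemma coeff_x_simps [simp]:
  "coeff_x i (u + v) = coeff_x i u + coeff_x i v" "coeff_x i (scaleE c u) = c * coeff_x i u"
  "coeff_x i (u * v) = coeff_x i u * counit_minus v + counit u * coeff_x i v"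
  "coeff_x i (1 :: ('n, 'k::field) E) = 0" "coeff_x i gE = 0" "coeff_x i (xE j) = (if i = j then 1 else 0)"
  by (simp_all add: coeff_x_def)

lemma linear_simps [simp]:
  "Vector_Spaces.linear scaleE (*) counit" "Vector_Spaces.linear scaleE (*) counit_minus"
  "Vector_Spaces.linear scaleE (*) (coeff_x i)"
  "Vector_Spaces.linear scaleE scaleE (diag b t)" "Vector_Spaces.linear scaleE scaleE (partial i)"
  by (simp_all add: field_alg.linear_iffE E.linear_iffE)

lemma diag_one: "diag True (\<lambda>_. 1) u = u"
proof (induction u rule: E_induct)
  case (gen u a)
  then show ?case by (cases a) auto
qed auto

lemma diag_diag: "diag True s (diag True t u) = diag True (\<lambda>i. s i * t i) u"
proof (induction u rule: E_induct)
  case (gen u a)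
  then show ?case by (cases a) (auto simp: mult.commute)
qed auto

text \<open>Setting every \<open>xE i\<close> to zero projects onto the span of \<open>1\<close> and
  \<open>gE\<close>, where the two characters determine both coefficients. The factor 2 avoids a
  division.\<close>

lemma diag_zero:
  "scaleE 2 (diag True (\<lambda>_. 0) u) = scaleE (counit u + counit_minus u) 1 + scaleE (counit u - counit_minus u) gE"
proof (induction u rule: E_induct)
  case (gen u a)
  have "scaleE 2 (diag True (\<lambda>_. 0) (u * E_gen a)) =
     (scaleE (counit u + counit_minus u) 1 + scaleE (counit u - counit_minus u) gE) * diag True (\<lambda>_. 0) (E_gen a)"
    by (simp only: gen[symmetric] diag_simps E.scale_mult_left)
  then show ?case
    by (cases a) (simp_all add: distrib_right E.scale_mult_left E_relations add_ac)
next
  case one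
  show ?case using E.scale_left_distrib[of 1 1 1] by simp
next
  case (add u v)
  then show ?case
    by (simp add: E.scale_right_distrib E.scale_left_distrib E.scale_left_diff_distrib)
next
  case (scale c u)
  have "scaleE 2 (diag True (\<lambda>_. 0) (scaleE c u)) = scaleE c (scaleE 2 (diag True (\<lambda>_. 0) u))"
    by (simp add: mult.commute)
  then show ?case
    unfolding scale by (simp add: E.scale_right_distrib distrib_left right_diff_distrib)
qed

section \<open>Partial evaluation of tensors\<close>

definition map_left :: "(('n, 'k) E \<Rightarrow> ('n, 'k) E) \<Rightarrow> ('n, 'k::field) EE \<Rightarrow> ('n, 'k) EE" where
  "map_left f = lift2 scaleEE (\<lambda>a b. f a \<otimes>\<^sub>k b)"

definition map_right :: "(('n, 'k) E \<Rightarrow> ('n, 'k) E) \<Rightarrow> ('n, 'k::field) EE \<Rightarrow> ('n, 'k) EE" where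
  "map_right f = lift2 scaleEE (\<lambda>a b. a \<otimes>\<^sub>k f b)"

definition slice_left :: "(('n, 'k) E \<Rightarrow> 'k) \<Rightarrow> ('n, 'k::field) EE \<Rightarrow> ('n, 'k) E" where
  "slice_left f = lift2 scaleE (\<lambda>a b. scaleE (f a) b)"

definition slice_right :: "(('n, 'k) E \<Rightarrow> 'k) \<Rightarrow> ('n, 'k::field) EE \<Rightarrow> ('n, 'k) E" where
  "slice_right f = lift2 scaleE (\<lambda>a b. scaleE (f b) a)"

definition slice3_left :: "(('n, 'k) E \<Rightarrow> 'k) \<Rightarrow> ('n, 'k::field) EEE \<Rightarrow> ('n, 'k) EE" where
  "slice3_left f = lift3 scaleEE (\<lambda>a b d. scaleEE (f a) (b \<otimes>\<^sub>k d))"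

definition slice3_right :: "(('n, 'k) E \<Rightarrow> 'k) \<Rightarrow> ('n, 'k::field) EEE \<Rightarrow> ('n, 'k) EE" where
  "slice3_right f = lift3 scaleEE (\<lambda>a b d. scaleEE (f d) (a \<otimes>\<^sub>k b))"

lemma map_simps [simp]:
  assumes "Vector_Spaces.linear scaleE scaleE f"
  shows "map_left f (a \<otimes>\<^sub>k b) = f a \<otimes>\<^sub>k b" "map_left f (S + T) = map_left f S + map_left f T"
    "map_left f (scaleEE c T) = scaleEE c (map_left f T)"
    "map_right f (a \<otimes>\<^sub>k b) = a \<otimes>\<^sub>k f b" "map_right f (S + T) = map_right f S + map_right f T"
    "map_right f (scaleEE c T) = scaleEE c (map_right f T)"
proof -
  have bil: "bilinear_map scaleEE (\<lambda>a b. f a \<otimes>\<^sub>k b)" "bilinear_map scaleEE (\<lambda>a b. a \<otimes>\<^sub>k f b)"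
    using assms by (simp_all add: bilinear_map_def EE.linear_iffE E.linear_iffE tensor2_simps)
  note s = EE.lift2_simps[OF bil(1)] EE.lift2_simps[OF bil(2)]
  show "map_left f (a \<otimes>\<^sub>k b) = f a \<otimes>\<^sub>k b" "map_left f (S + T) = map_left f S + map_left f T"
    "map_left f (scaleEE c T) = scaleEE c (map_left f T)"
    "map_right f (a \<otimes>\<^sub>k b) = a \<otimes>\<^sub>k f b" "map_right f (S + T) = map_right f S + map_right f T"
    "map_right f (scaleEE c T) = scaleEE c (map_right f T)"
    by (simp_all add: map_left_def map_right_def s)
qed

lemma slice_simps [simp]:
  assumes "Vector_Spaces.linear scaleE (*) f"
  shows "slice_left f (a \<otimes>\<^sub>k b) = scaleE (f a) b" "slice_left f (S + T) = slice_left f S + slice_left f T"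
    "slice_left f (scaleEE c T) = scaleE c (slice_left f T)"
    "slice_right f (a \<otimes>\<^sub>k b) = scaleE (f b) a" "slice_right f (S + T) = slice_right f S + slice_right f T"
    "slice_right f (scaleEE c T) = scaleE c (slice_right f T)"
proof -
  have bil: "bilinear_map scaleE (\<lambda>a b. scaleE (f a) b)" "bilinear_map scaleE (\<lambda>a b. scaleE (f b) a)"
    using assms by (simp_all add: bilinear_map_def E.linear_iffE field_alg.linear_iffE
        E.scale_left_distrib E.scale_right_distrib mult.commute)
  note s = E.lift2_simps[OF bil(1)] E.lift2_simps[OF bil(2)]
  show "slice_left f (a \<otimes>\<^sub>k b) = scaleE (f a) b" "slice_left f (S + T) = slice_left f S + slice_left f T"
    "slice_left f (scaleEE c T) = scaleE c (slice_left f T)"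
    "slice_right f (a \<otimes>\<^sub>k b) = scaleE (f b) a" "slice_right f (S + T) = slice_right f S + slice_right f T"
    "slice_right f (scaleEE c T) = scaleE c (slice_right f T)"
    by (simp_all add: slice_left_def slice_right_def s)
qed

lemma slice3_simps [simp]:
  assumes "Vector_Spaces.linear scaleE (*) f"
  shows "slice3_left f (tensor3 a b d) = scaleEE (f a) (b \<otimes>\<^sub>k d)"
    "slice3_left f (S + T) = slice3_left f S + slice3_left f T"
    "slice3_left f (scaleEEE c T) = scaleEE c (slice3_left f T)"
    "slice3_right f (tensor3 a b d) = scaleEE (f d) (a \<otimes>\<^sub>k b)"
    "slice3_right f (S + T) = slice3_right f S + slice3_right f T"
    "slice3_right f (scaleEEE c T) = scaleEE c (slice3_right f T)"
proof -
  have tril: "trilinear_map scaleEE (\<lambda>a b d. scaleEE (f a) (b \<otimes>\<^sub>k d))"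
    "trilinear_map scaleEE (\<lambda>a b d. scaleEE (f d) (a \<otimes>\<^sub>k b))"
    using assms by (simp_all add: trilinear_map_def EE.linear_iffE field_alg.linear_iffE
        EE.scale_left_distrib EE.scale_right_distrib mult.commute tensor2_simps(1-4))
  note s = EE.lift3_simps[OF tril(1)] EE.lift3_simps[OF tril(2)]
  show "slice3_left f (tensor3 a b d) = scaleEE (f a) (b \<otimes>\<^sub>k d)"
    "slice3_left f (S + T) = slice3_left f S + slice3_left f T"
    "slice3_left f (scaleEEE c T) = scaleEE c (slice3_left f T)"
    "slice3_right f (tensor3 a b d) = scaleEE (f d) (a \<otimes>\<^sub>k b)"
    "slice3_right f (S + T) = slice3_right f S + slice3_right f T"
    "slice3_right f (scaleEEE c T) = scaleEE c (slice3_right f T)"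
    by (simp_all add: slice3_left_def slice3_right_def s)
qed

lemma map_zero [simp]:
  "Vector_Spaces.linear scaleE scaleE f \<Longrightarrow> map_left f 0 = 0"
  "Vector_Spaces.linear scaleE scaleE f \<Longrightarrow> map_right f 0 = 0"
  using map_simps(3)[of f 0 0] map_simps(6)[of f 0 0] by simp_all

lemma slice_zero [simp]:
  "Vector_Spaces.linear scaleE (*) f \<Longrightarrow> slice_left f 0 = 0"
  "Vector_Spaces.linear scaleE (*) f \<Longrightarrow> slice_right f 0 = 0"
  "Vector_Spaces.linear scaleE (*) f \<Longrightarrow> slice3_left f 0 = 0"
  "Vector_Spaces.linear scaleE (*) f \<Longrightarrow> slice3_right f 0 = 0"
  using slice_simps(3)[of f 0 0] slice_simps(6)[of f 0 0] slice3_simps(3)[of f 0 0] slice3_simps(6)[of f 0 0]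
  by simp_all

lemma leg_zero [simp]:
  "leg12 (0 :: ('n, 'k::field) EE) = 0" "leg23 (0 :: ('n, 'k::field) EE) = 0" "leg13 (0 :: ('n, 'k::field) EE) = 0"
  "id_comult (0 :: ('n, 'k::field) EE) = 0" "comult_id (0 :: ('n, 'k::field) EE) = 0"
  using leg12_simps(3)[of 0 0] leg23_simps(3)[of 0 0] leg13_simps(2)[of 0 0] id_comult_simps(2)[of 0 0]
    comult_id_simps(2)[of 0 0] by simp_all

lemma diff_simps [simp]:
  "counit (u - v) = counit u - counit v" "counit_minus (u - v) = counit_minus u - counit_minus v"
  "partial i (u - v) = partial i u - partial i v"
  "Vector_Spaces.linear scaleE scaleE h \<Longrightarrow> map_left h (S - T) = map_left h S - map_left h T"
  "Vector_Spaces.linear scaleE (*) f \<Longrightarrow> slice_left f (S - T) = slice_left f S - slice_left f T"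
  using counit_simps(2)[of "u - v" v] counit_minus_simps(2)[of "u - v" v] partial_simps(1)[of i "u - v" v]
    map_simps(2)[of h "S - T" T] slice_simps(2)[of f "S - T" T]
  by (simp_all add: eq_diff_eq)

lemma slice_sum:
  assumes [simp]: "Vector_Spaces.linear scaleE (*) f"
  shows "slice_left f (sum h A) = (\<Sum>i\<in>A. slice_left f (h i))"
    "slice_right f (sum h A) = (\<Sum>i\<in>A. slice_right f (h i))"
  by (induction A rule: infinite_finite_induct) simp_all

lemma tensor2_diff: "a \<otimes>\<^sub>k (b - b') = (a \<otimes>\<^sub>k b) - (a \<otimes>\<^sub>k b')"
  using tensor2_simps(2)[of a b "- b'"] by simp

lemma slice_left_mult:
  assumes [simp]: "Vector_Spaces.linear scaleE (*) f" and f: "\<And>a b. f (a * b) = f a * f b"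
  shows "slice_left f (S * T) = slice_left f S * slice_left f T"
proof (induction S rule: EE_induct)
  case (pure a b)
  show ?case
    by (induction T rule: EE_induct)
       (simp_all add: distrib_left EE.scale_mult_right E.scale_mult_right E.scale_mult_left f
         flip: tensor2_simps(5))
qed (simp_all add: distrib_right EE.scale_mult_left E.scale_mult_left)

lemma slice_right_mult:
  assumes [simp]: "Vector_Spaces.linear scaleE (*) f" and f: "\<And>a b. f (a * b) = f a * f b"
  shows "slice_right f (S * T) = slice_right f S * slice_right f T"
proof (induction S rule: EE_induct)
  case (pure a b)
  show ?case
    by (induction T rule: EE_induct)
       (simp_all add: distrib_left EE.scale_mult_right E.scale_mult_right E.scale_mult_left f
         flip: tensor2_simps(5))
qed (simp_all add: distrib_right EE.scale_mult_left E.scale_mult_left)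

context
  fixes f :: "('n, 'k::field) E \<Rightarrow> 'k"
  assumes lin [simp]: "Vector_Spaces.linear scaleE (*) f"
begin

lemma slice3_left_tensor_leg23: "slice3_left f (tensor3 a 1 1 * leg23 S) = scaleEE (f a) S"
  by (induction S rule: EE_induct)
     (simp_all add: leg23_simps distrib_left EE.scale_right_distrib EEE.scale_mult_right mult.commute
       flip: tensor3_simps(7))

lemma slice3_right_leg12_tensor: "slice3_right f (leg12 S * tensor3 1 1 b) = scaleEE (f b) S"
  by (induction S rule: EE_induct)
     (simp_all add: leg12_simps distrib_right EE.scale_right_distrib EEE.scale_mult_left mult.commute
       flip: tensor3_simps(7))

lemma slice3_leg:
  "slice3_left f (leg23 T) = scaleEE (f 1) T"
  "slice3_right f (leg12 T) = scaleEE (f 1) T"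
  "slice3_left f (leg12 T) = slice_left f T \<otimes>\<^sub>k 1"
  using slice3_left_tensor_leg23[of 1 T] slice3_right_leg12_tensor[of T 1]
proof -
  show "slice3_left f (leg12 T) = slice_left f T \<otimes>\<^sub>k 1"
    by (induction T rule: EE_induct) (simp_all add: leg12_simps tensor2_simps(1-4))
qed (simp_all add: tensor3_simps(8))

text \<open>An element in the first leg commutes with \<open>leg23 S\<close>, so evaluating that leg
  passes through the conjugation. This brings the hexagon axioms down to the tensor square.\<close>

lemma slice3_left_conj:
  "slice3_left f (leg23 S * leg13 T * leg23 S') = S * (1 \<otimes>\<^sub>k slice_left f T) * S'"
proof (induction T rule: EE_induct)
  case (pure a b)
  have "leg23 S * leg13 (a \<otimes>\<^sub>k b) * leg23 S' = leg23 S * (tensor3 a 1 1 * leg23 (1 \<otimes>\<^sub>k b)) * leg23 S'"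
    by (simp add: leg13_pure leg23_simps flip: tensor3_simps(7))
  also have "\<dots> = tensor3 a 1 1 * leg23 (S * (1 \<otimes>\<^sub>k b) * S')"
    by (simp add: leg23_simps(2) leg23_commute flip: mult.assoc)
  finally show ?case
    by (simp add: slice3_left_tensor_leg23 tensor2_simps(4) EE.scale_mult_left EE.scale_mult_right)
qed (simp_all add: leg13_simps distrib_left distrib_right tensor2_simps(2,4)
    EE.scale_mult_left EE.scale_mult_right EEE.scale_mult_left EEE.scale_mult_right)

lemma slice3_right_conj:
  "slice3_right f (leg12 S * leg13 T * leg12 S') = S * (slice_right f T \<otimes>\<^sub>k 1) * S'"
proof (induction T rule: EE_induct)
  case (pure a b)
  have "leg12 S * leg13 (a \<otimes>\<^sub>k b) * leg12 S' = leg12 S * (leg12 (a \<otimes>\<^sub>k 1) * tensor3 1 1 b) * leg12 S'"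
    by (simp add: leg13_pure leg12_simps flip: tensor3_simps(7))
  also have "\<dots> = leg12 (S * (a \<otimes>\<^sub>k 1) * S') * tensor3 1 1 b"
    by (simp add: leg12_simps(2) mult.assoc leg12_commute[symmetric])
  finally show ?case
    by (simp add: slice3_right_leg12_tensor tensor2_simps(3) EE.scale_mult_left EE.scale_mult_right)
qed (simp_all add: leg13_simps distrib_left distrib_right tensor2_simps(1,3)
    EE.scale_mult_left EE.scale_mult_right EEE.scale_mult_left EEE.scale_mult_right)

lemma slice3_left_comult_id:
  assumes [simp]: "Vector_Spaces.linear scaleE scaleE h" and h: "\<And>a. slice_left f (comult a) = h a"
  shows "slice3_left f (comult_id T) = map_left h T"
proof (induction T rule: EE_induct)
  case (pure a b)
  have "slice3_left f (leg12 S * tensor3 1 1 b) = slice_left f S \<otimes>\<^sub>k b" for S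
    by (induction S rule: EE_induct)
       (simp_all add: leg12_simps distrib_right EEE.scale_mult_left tensor2_simps(1-4) flip: tensor3_simps(7))
  then show ?case by (simp add: comult_id_simps h)
qed (simp_all add: comult_id_simps)

lemma slice3_right_id_comult:
  assumes [simp]: "Vector_Spaces.linear scaleE scaleE h" and h: "\<And>a. slice_right f (comult a) = h a"
  shows "slice3_right f (id_comult T) = map_right h T"
proof (induction T rule: EE_induct)
  case (pure a b)
  have "slice3_right f (tensor3 a 1 1 * leg23 S) = a \<otimes>\<^sub>k slice_right f S" for S
    by (induction S rule: EE_induct)
       (simp_all add: leg23_simps distrib_left EEE.scale_mult_right tensor2_simps(1-4) flip: tensor3_simps(7))
  then show ?case by (simp add: id_comult_simps h)
qed (simp_all add: id_comult_simps)

lemma slice3_left_id_comult: "slice3_left f (id_comult T) = comult (slice_left f T)"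
proof -
  have "comult (0 :: ('n, 'k) E) = 0" using comult_simps(3)[of 0 0] by simp
  then show ?thesis
    by (induction T rule: EE_induct)
       (simp_all add: id_comult_simps comult_simps(1,3) slice3_left_tensor_leg23)
qed

lemma slice_left_map_right:
  assumes "Vector_Spaces.linear scaleE scaleE h"
  shows "slice_left f (map_right h T) = h (slice_left f T)"
proof -
  have h: "h (a + b) = h a + h b" "h (scaleE c a) = scaleE c (h a)" for a b c
    using assms by (simp_all add: E.linear_iffE)
  moreover have "h 0 = 0" using h(2)[of 0 0] by simp
  ultimately show ?thesis
    by (induction T rule: EE_induct) (simp_all add: assms)
qed

end

section \<open>Properties of \<open>R\<^sub>A\<close>\<close>

lemmas tensor2_mult = tensor2_simps(5)[symmetric]

lemma E_rewrites:
  fixes u :: "('n, 'k::field) E"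
  shows "gE * gE = (1 :: ('n, 'k) E)" "gE * (gE * u) = u"
    "xE i * gE = - (gE * xE i :: ('n, 'k) E)" "xE i * (gE * u) = - (gE * (xE i * u))"
    "xE i * xE i = (0 :: ('n, 'k) E)" "xE i * (xE i * u) = 0"
proof -
  show xg: "xE i * gE = - (gE * xE i :: ('n, 'k) E)" by (simp add: E_relations(3))
  show "gE * (gE * u) = u" "xE i * (xE i * u) = 0"
    by (simp_all add: E_relations(1,2) flip: mult.assoc)
  have "xE i * (gE * u) = (xE i * gE) * u" by (simp only: mult.assoc)
  then show "xE i * (gE * u) = - (gE * (xE i * u))" by (simp add: xg mult.assoc)
qed (rule E_relations)+

text \<open>All monomials in the generators commute up to a sign, and signs multiply along products.
  Carrying the sign as a parameter reduces commutation of pure tensors to two signs cancelling, as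
  in \<open>tensor2_commute\<close>.\<close>

definition skew_commute :: "'k \<Rightarrow> ('n, 'k::field) E \<Rightarrow> ('n, 'k) E \<Rightarrow> bool" where
  "skew_commute c u v \<longleftrightarrow> u * v = scaleE c (v * u)"

lemma skew_commute_gen:
  "skew_commute 1 gE gE" "skew_commute (- 1) gE (xE i)" "skew_commute (- 1) (xE i) gE"
  "skew_commute (- 1) (xE i) (xE j)"
  by (simp_all add: skew_commute_def E_rewrites) (rule E_relations)

lemma skew_commute_one: "skew_commute 1 1 u" "skew_commute 1 u 1"
  by (simp_all add: skew_commute_def)

lemma skew_commute_mult:
  "skew_commute c u v \<Longrightarrow> skew_commute d u w \<Longrightarrow> skew_commute (c * d) u (v * w)"
  "skew_commute c u w \<Longrightarrow> skew_commute d v w \<Longrightarrow> skew_commute (c * d) (u * v) w"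
proof -
  assume "skew_commute c u v" "skew_commute d u w"
  then have "u * v = scaleE c (v * u)" "u * w = scaleE d (w * u)"
    by (simp_all add: skew_commute_def)
  moreover have "u * (v * w) = (u * v) * w" "v * (u * w) = v * u * w"
    by (simp_all add: mult.assoc)
  ultimately show "skew_commute (c * d) u (v * w)"
    by (simp add: skew_commute_def E.scale_mult_left E.scale_mult_right mult.assoc)
next
  assume "skew_commute c u w" "skew_commute d v w"
  then have uw: "u * w = scaleE c (w * u)" and vw: "v * w = scaleE d (w * v)"
    by (simp_all add: skew_commute_def)
  have "u * v * w = scaleE d (u * w * v)"
    by (simp add: mult.assoc vw E.scale_mult_right)
  then show "skew_commute (c * d) (u * v) w"
    by (simp add: skew_commute_def uw E.scale_mult_left mult.assoc mult.commute)
qed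

lemma skew_commute_power: "skew_commute c u v \<Longrightarrow> skew_commute (c ^ k) (u ^ k) v"
  by (induction k) (auto intro: skew_commute_one skew_commute_mult)

lemma skew_commute_power_right: "skew_commute c u v \<Longrightarrow> skew_commute (c ^ k) u (v ^ k)"
  by (induction k) (auto intro: skew_commute_one skew_commute_mult)

lemma skew_commute_prod_list:
  "(\<And>i. skew_commute c u (f i)) \<Longrightarrow> skew_commute (c ^ length ws) u (prod_list (map f ws))"
  "(\<And>i. skew_commute c (f i) u) \<Longrightarrow> skew_commute (c ^ length ws) (prod_list (map f ws)) u"
  by (induction ws) (auto intro: skew_commute_one skew_commute_mult)

lemma skew_commute_xE_prod:
  fixes P :: "'n::{finite, linorder} set"
  shows "(\<And>i. skew_commute c u (xE i)) \<Longrightarrow> skew_commute (c ^ card P) u (xE_prod P)"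
    "(\<And>i. skew_commute c (xE i) u) \<Longrightarrow> skew_commute (c ^ card P) (xE_prod P) u"
  using skew_commute_prod_list(1)[of c u xE "sorted_list_of_set P"]
    skew_commute_prod_list(2)[of c xE u "sorted_list_of_set P"]
  by (simp_all add: xE_prod_def)

lemma tensor2_commute:
  assumes "skew_commute c a a'" "skew_commute d b b'" "c * d = 1"
  shows "(a \<otimes>\<^sub>k b) * (a' \<otimes>\<^sub>k b') = (a' \<otimes>\<^sub>k b') * (a \<otimes>\<^sub>k b)"
  using assms by (simp add: tensor2_mult skew_commute_def tensor2_simps(3,4) mult.commute)

lemma counit_xE_prod:
  assumes "P \<noteq> {}"
  shows "counit (xE_prod P :: ('n::{finite, linorder}, 'k::field) E) = 0"
    "counit_minus (xE_prod P :: ('n::{finite, linorder}, 'k::field) E) = 0"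
proof -
  obtain i ws where "sorted_list_of_set P = i # ws"
    using assms by (metis finite list.exhaust set_sorted_list_of_set empty_set)
  then show "counit (xE_prod P :: ('n, 'k) E) = 0" "counit_minus (xE_prod P :: ('n, 'k) E) = 0"
    by (simp_all add: xE_prod_def)
qed

text \<open>The first factor of the right copy moves, up to sign, to the front of the left copy,
  where it meets itself and squares to zero.\<close>

lemma xE_prod_square:
  assumes "P \<noteq> {}"
  shows "xE_prod P * xE_prod P = (0 :: ('n::{finite, linorder}, 'k::field) E)"
proof -
  obtain i ws where ws: "sorted_list_of_set P = i # ws"
    using assms by (metis finite list.exhaust set_sorted_list_of_set empty_set)
  have "xE i * (xE_prod P * u) = 0" for u :: "('n, 'k) E"
    by (simp add: ws xE_prod_def mult.assoc E_rewrites)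
  moreover have "xE_prod P * xE i = scaleE ((- 1) ^ card P) (xE i * (xE_prod P :: ('n, 'k) E))"
    using skew_commute_xE_prod(2)[OF skew_commute_gen(4)] by (simp add: skew_commute_def)
  moreover have "(xE_prod P :: ('n, 'k) E) = xE i * prod_list (map xE ws)"
    by (simp add: ws xE_prod_def)
  ultimately show ?thesis
    by (metis (no_types, lifting) E.scale_mult_left E.scale_zero_right mult.assoc mult_1_right mult_zero_left)
qed

lemma invertible_one_plus_sum:
  fixes n :: "'i \<Rightarrow> 'a::ring_1"
  assumes "finite S" "\<And>i. i \<in> S \<Longrightarrow> n i * n i = 0" "\<And>i j. i \<in> S \<Longrightarrow> j \<in> S \<Longrightarrow> n i * n j = n j * n i"
  shows "\<exists>v. (1 + sum n S) * v = 1 \<and> v * (1 + sum n S) = 1"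
  using assms
proof (induction S)
  case empty
  then show ?case by (intro exI[of _ 1]) simp
next
  case (insert i S)
  define u where "u = 1 + sum n S"
  let ?a = "n i"
  obtain v where v: "u * v = 1" "v * u = 1"
    using insert unfolding u_def by auto
  have au: "?a * u = u * ?a"
    unfolding u_def using insert.prems(2) by (simp add: distrib_left distrib_right sum_distrib_left sum_distrib_right)
  have "v * (?a * u) * v = v * (u * ?a) * v"
    by (simp only: au)
  then have va: "v * ?a = ?a * v"
    by (metis mult.assoc mult_1_left mult_1_right v)
  have rules: "?a * (?a * w) = 0" "v * (u * w) = w" "u * (v * w) = w"
    "u * (?a * w) = ?a * (u * w)" "v * (?a * w) = ?a * (v * w)" for w
    using insert.prems(1) by (simp_all add: v au va flip: mult.assoc)
  \<comment> \<open>The geometric series for the inverse of \<open>u + ?a\<close> stops after the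
    linear term, because \<open>?a\<close> squares to zero and commutes with \<open>u\<close> and
    \<open>v\<close>.\<close>
  have "(u + ?a) * (v - ?a * (v * v)) = 1" "(v - ?a * (v * v)) * (u + ?a) = 1"
    by (simp_all add: distrib_left distrib_right left_diff_distrib right_diff_distrib mult.assoc rules v va)
  moreover have "1 + sum n (insert i S) = u + ?a"
    using insert by (simp add: u_def add_ac)
  ultimately show ?case by auto
qed

section \<open>Factorization, commutation rules and invertibility of \<open>R_A\<close>\<close>

definition R_semisimple :: "('n, 'k::field) EE" where
  "R_semisimple = scaleEE (1 / 2) ((1 \<otimes>\<^sub>k 1) + (1 \<otimes>\<^sub>k gE) + (gE \<otimes>\<^sub>k 1) - (gE \<otimes>\<^sub>k gE))"

definition R_term :: "'n::{finite, linorder} set \<times> 'n set \<Rightarrow> ('n, 'k::field) EE" where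
  "R_term = (\<lambda>(P, F). (gE ^ card P * xE_prod F) \<otimes>\<^sub>k xE_prod P)"

definition R_index :: "('n::{finite, linorder} set \<times> 'n set) set" where
  "R_index = {(P, F). P \<noteq> {} \<and> F \<noteq> {} \<and> card F = card P}"

definition R_coeff :: "'k::field ^ 'n::{finite, linorder} ^ 'n::{finite, linorder} \<Rightarrow> 'n set \<times> 'n set \<Rightarrow> 'k" where
  "R_coeff A = (\<lambda>(P, F). (- 1) ^ (card P * (card P - 1) div 2) * minor A P F)"

text \<open>The four tensors attached to a pair \<open>(P, F)\<close> are the products of the four
  summands of \<open>R_semisimple\<close> with \<open>R_term (P, F)\<close>, so
  \<open>R_semisimple\<close> factors out on the left.\<close>

lemma R_A_factorization:
  fixes A :: "'k::field ^ 'n::{finite, linorder} ^ 'n::{finite, linorder}"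
  shows "R_A A = R_semisimple * (1 + (\<Sum>i\<in>R_index. scaleEE (R_coeff A i) (R_term i)))"
proof -
  have "R_semisimple * R_term (P, F) = scaleEE (1 / 2)
      ((gE ^ card P * xE_prod F \<otimes>\<^sub>k xE_prod P) + (gE ^ card P * xE_prod F \<otimes>\<^sub>k gE * xE_prod P) +
       (gE ^ (card P + 1) * xE_prod F \<otimes>\<^sub>k xE_prod P) -
       (gE ^ (card P + 1) * xE_prod F \<otimes>\<^sub>k gE * xE_prod P) :: ('n, 'k) EE)" for P F :: "'n set"
    by (simp add: R_semisimple_def R_term_def EE.scale_mult_left distrib_right left_diff_distrib
        tensor2_mult mult.assoc)
  then have "(\<Sum>i\<in>R_index. scaleEE (R_coeff A i) (R_semisimple * R_term i)) =
      scaleEE (1 / 2) (\<Sum>(P, F) \<in> {(P, F). P \<noteq> {} \<and> F \<noteq> {} \<and> card F = card P}.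
       scaleEE ((- 1) ^ (card P * (card P - 1) div 2) * minor A P F)
         ((gE ^ card P * xE_prod F \<otimes>\<^sub>k xE_prod P) + (gE ^ card P * xE_prod F \<otimes>\<^sub>k gE * xE_prod P) +
          (gE ^ (card P + 1) * xE_prod F \<otimes>\<^sub>k xE_prod P) -
          (gE ^ (card P + 1) * xE_prod F \<otimes>\<^sub>k gE * xE_prod P)))"
    unfolding EE.scale_sum_right
    by (intro sum.cong) (auto simp: R_index_def R_coeff_def mult.commute)
  then show ?thesis
    by (simp only: R_A_def distrib_left mult_1_right sum_distrib_left EE.scale_mult_right)
       (simp only: R_semisimple_def)
qed

text \<open>Since \<open>card F = card P\<close>, all exchanges with a single generator contribute
  the same sign, and over the two tensor factors it occurs an even number of times. For two terms
  the common sign has exponent \<open>card P * card Q\<close> and occurs four times. Squares vanish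
  because \<open>xE_prod P\<close> squares to zero.\<close>

lemma R_term_commute:
  assumes "i \<in> R_index"
  shows "((gE * xE p) \<otimes>\<^sub>k gE) * R_term i = (R_term i * ((gE * xE p) \<otimes>\<^sub>k gE) :: ('n::{finite, linorder}, 'k::field) EE)"
    "(gE \<otimes>\<^sub>k xE p) * R_term i = (R_term i * (gE \<otimes>\<^sub>k xE p) :: ('n, 'k) EE)"
    "(gE \<otimes>\<^sub>k gE) * R_term i = (R_term i * (gE \<otimes>\<^sub>k gE) :: ('n, 'k) EE)"
    "j \<in> R_index \<Longrightarrow> R_term i * R_term j = (R_term j * R_term i :: ('n, 'k) EE)"
    "R_term i * R_term i = (0 :: ('n, 'k) EE)"
proof -
  obtain P F where i: "i = (P, F)" "P \<noteq> {}" "card F = card P"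
    using assms by (auto simp: R_index_def)
  note gens = skew_commute_gen
  note g = skew_commute_xE_prod(1)[OF gens(2)] and x = skew_commute_xE_prod(1)[OF gens(4)]
    and xg = skew_commute_xE_prod(2)[OF gens(3)] and xx = skew_commute_xE_prod(2)[OF gens(4)]
  note m = skew_commute_mult and pw = skew_commute_power_right
  let ?s = "(- 1) ^ card P :: 'k"
  have ss: "?s * ?s = 1" by (simp flip: power_add)
  have "skew_commute (1 ^ card P * ?s * (?s * ?s)) (gE * xE p) (gE ^ card P * xE_prod F)"
  proof (rule m(1))
    show "skew_commute (1 ^ card P * ?s) (gE * xE p) (gE ^ card P)"
      by (rule m(2)[OF pw[OF gens(1)] pw[OF gens(3)]])
    show "skew_commute (?s * ?s) (gE * xE p) (xE_prod F)"
      using m(2)[OF g x, of F p] i by simp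
  qed
  from tensor2_commute[OF this g[of P]] ss
  show "((gE * xE p) \<otimes>\<^sub>k gE) * R_term i = (R_term i * ((gE * xE p) \<otimes>\<^sub>k gE) :: ('n, 'k) EE)"
    by (simp add: i R_term_def)
  have gt: "skew_commute (1 ^ card P * ?s) gE (gE ^ card P * xE_prod F)"
    using m(1)[OF pw[OF gens(1)] g, of "card P" F] i by simp
  from tensor2_commute[OF gt x[of P p]] ss
  show "(gE \<otimes>\<^sub>k xE p) * R_term i = (R_term i * (gE \<otimes>\<^sub>k xE p) :: ('n, 'k) EE)"
    by (simp add: i R_term_def)
  from tensor2_commute[OF gt g[of P]] ss
  show "(gE \<otimes>\<^sub>k gE) * R_term i = (R_term i * (gE \<otimes>\<^sub>k gE) :: ('n, 'k) EE)"
    by (simp add: i R_term_def)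
  show "R_term i * R_term i = (0 :: ('n, 'k) EE)"
    using i by (simp add: R_term_def tensor2_mult xE_prod_square)
  assume "j \<in> R_index"
  then obtain Q H where j: "j = (Q, H)" "card H = card Q"
    by (auto simp: R_index_def)
  let ?t = "?s ^ card Q"
  have tt: "?t * ?t = 1" by (simp add: ss flip: power_mult_distrib)
  have xx: "skew_commute ((c ^ card H) ^ card F) (xE_prod F) (xE_prod H)"
    if "\<And>i j :: 'n. skew_commute c (xE i) (xE j)" for c :: 'k and F H :: "'n set"
    by (rule skew_commute_xE_prod(2)) (rule skew_commute_xE_prod(1)[OF that])
  have e: "((- 1) ^ card Q) ^ card P = ?t"
    by (simp add: mult.commute flip: power_mult)
  have "skew_commute ((1 ^ card Q) ^ card P * ?t * (?t * ?t)) (gE ^ card P * xE_prod F) (gE ^ card Q * xE_prod H)"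
  proof (rule m(1))
    have "skew_commute ((1 ^ card Q) ^ card P) (gE ^ card P) (gE ^ card Q)"
      by (rule skew_commute_power[OF pw[OF gens(1)]])
    moreover have "skew_commute ?t (xE_prod F) (gE ^ card Q)"
      using pw[OF xg[of F], of "card Q"] i by simp
    ultimately show "skew_commute ((1 ^ card Q) ^ card P * ?t) (gE ^ card P * xE_prod F) (gE ^ card Q)"
      by (rule m(2))
    have "skew_commute (((- 1 :: 'k) ^ card H) ^ card P) (gE ^ card P) (xE_prod H)"
      by (rule skew_commute_power[OF g])
    then have "skew_commute ?t (gE ^ card P) (xE_prod H)"
      by (simp only: j e)
    moreover have "skew_commute ?t (xE_prod F) (xE_prod H)"
    proof -
      have "skew_commute (((- 1 :: 'k) ^ card H) ^ card F) (xE_prod F) (xE_prod H)"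
        by (rule xx[OF gens(4)])
      then show ?thesis by (simp only: i j e)
    qed
    ultimately show "skew_commute (?t * ?t) (gE ^ card P * xE_prod F) (xE_prod H)"
      by (rule m(2))
  qed
  moreover have "skew_commute ?t (xE_prod P) (xE_prod Q)"
  proof -
    have "skew_commute (((- 1 :: 'k) ^ card Q) ^ card P) (xE_prod P) (xE_prod Q)"
      by (rule xx[OF gens(4)])
    then show ?thesis by (simp only: e)
  qed
  ultimately show "R_term i * R_term j = (R_term j * R_term i :: ('n, 'k) EE)"
    using tensor2_commute tt by (simp add: i j R_term_def)
qed

text \<open>With the idempotents \<open>e = (1 + g)/2\<close> and \<open>f = (1 - g)/2\<close>,
  \<open>R_semisimple\<close> is \<open>e \<otimes> 1 + f \<otimes> g\<close>, and it is symmetric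
  in its two factors. An odd element passing through one factor exchanges \<open>e\<close> and
  \<open>f\<close>, which amounts to multiplying the other factor by \<open>g\<close>.\<close>

lemma R_semisimple_commute:
  "((gE * xE p) \<otimes>\<^sub>k 1) * R_semisimple = R_semisimple * ((gE * xE p) \<otimes>\<^sub>k gE)"
  "(1 \<otimes>\<^sub>k xE p) * R_semisimple = R_semisimple * (gE \<otimes>\<^sub>k xE p)"
  "(gE \<otimes>\<^sub>k gE) * R_semisimple = R_semisimple * (gE \<otimes>\<^sub>k gE)"
  by (simp_all add: R_semisimple_def EE.scale_mult_left EE.scale_mult_right distrib_left distrib_right
      left_diff_distrib right_diff_distrib tensor2_mult E_rewrites mult.assoc add_ac)

text \<open>Only the semisimple factor alters the element that is moved; the altered element
  commutes with every \<open>R_term\<close>. Hence the rules are the same for all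
  \<open>A\<close>.\<close>

lemma R_A_commute:
  "((gE * xE p) \<otimes>\<^sub>k 1) * R_A A = R_A A * ((gE * xE p) \<otimes>\<^sub>k gE)"
  "(1 \<otimes>\<^sub>k xE p) * R_A A = R_A A * (gE \<otimes>\<^sub>k xE p)"
  "(gE \<otimes>\<^sub>k gE) * R_A A = R_A A * (gE \<otimes>\<^sub>k gE)"
proof -
  let ?N = "\<Sum>i\<in>R_index. scaleEE (R_coeff A i) (R_term i)"
  have N: "S * (1 + ?N) = (1 + ?N) * S" if "\<And>i. i \<in> R_index \<Longrightarrow> S * R_term i = R_term i * S" for S
    using that by (simp add: distrib_left distrib_right sum_distrib_left sum_distrib_right
        EE.scale_mult_left EE.scale_mult_right)
  have *: "S * R_A A = R_A A * S'"
    if "S * R_semisimple = R_semisimple * S'" "\<And>i. i \<in> R_index \<Longrightarrow> S' * R_term i = R_term i * S'" for S S'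
  proof -
    have "S * R_A A = (S * R_semisimple) * (1 + ?N)"
      by (simp only: R_A_factorization mult.assoc)
    also have "\<dots> = R_semisimple * (S' * (1 + ?N))"
      by (simp only: that(1) mult.assoc)
    also have "\<dots> = R_A A * S'"
      by (simp only: N[OF that(2)] R_A_factorization mult.assoc)
    finally show ?thesis .
  qed
  show "((gE * xE p) \<otimes>\<^sub>k 1) * R_A A = R_A A * ((gE * xE p) \<otimes>\<^sub>k gE)"
    "(1 \<otimes>\<^sub>k xE p) * R_A A = R_A A * (gE \<otimes>\<^sub>k xE p)"
    "(gE \<otimes>\<^sub>k gE) * R_A A = R_A A * (gE \<otimes>\<^sub>k gE)"
    by (rule *[OF R_semisimple_commute(1) R_term_commute(1)] *[OF R_semisimple_commute(2) R_term_commute(2)]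
        *[OF R_semisimple_commute(3) R_term_commute(3)], assumption)+
qed

context
  fixes A :: "'k::field ^ 'n::{finite, linorder} ^ 'n::{finite, linorder}"
  assumes two: "(2 :: 'k) \<noteq> 0"
begin

lemma R_semisimple_square: "R_semisimple * R_semisimple = (1 :: ('n, 'k) EE)"
proof -
  let ?T = "(1 \<otimes>\<^sub>k 1) + (1 \<otimes>\<^sub>k gE) + (gE \<otimes>\<^sub>k 1) - (gE \<otimes>\<^sub>k gE) :: ('n, 'k) EE"
  have "?T * ?T = 1 + 1 + 1 + 1"
    by (simp add: distrib_left distrib_right left_diff_distrib right_diff_distrib tensor2_mult
        E_rewrites tensor2_simps(6) algebra_simps)
  also have "\<dots> = scaleEE (1 + 1 + 1 + 1) 1"
    by (simp only: EE.scale_left_distrib EE.scale_one)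
  finally have "R_semisimple * R_semisimple = scaleEE (1 / 2 * (1 / 2) * (1 + 1 + 1 + 1)) (1 :: ('n, 'k) EE)"
    by (simp only: R_semisimple_def EE.scale_mult_left EE.scale_mult_right EE.scale_scale mult_ac)
  also have "1 / 2 * (1 / 2) * (1 + 1 + 1 + 1) = (1 :: 'k)"
  proof -
    have "1 / 2 * (1 / 2) * (1 + 1 + 1 + 1) = (1 / 2 * 2) * (1 / 2 * (2 :: 'k))"
      by (simp only: mult.assoc mult.left_commute[of 2]) simp
    then show ?thesis using two by simp
  qed
  finally show ?thesis by simp
qed

lemma R_A_invertible: "\<exists>R'. R_A A * R' = 1 \<and> R' * R_A A = 1"
proof -
  let ?N = "\<Sum>i\<in>R_index. scaleEE (R_coeff A i) (R_term i) :: ('n, 'k) EE"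
  have "\<exists>v. (1 + ?N) * v = 1 \<and> v * (1 + ?N) = 1"
    by (rule invertible_one_plus_sum[OF finite])
       (simp_all add: EE.scale_mult_left EE.scale_mult_right R_term_commute(5) R_term_commute(4) mult.commute)
  then obtain v where v: "(1 + ?N) * v = 1" "v * (1 + ?N) = 1" by blast
  have "(1 + ?N) * (v * w) = w" "R_semisimple * (R_semisimple * w) = w" for w :: "('n, 'k) EE"
    by (simp_all add: v R_semisimple_square flip: mult.assoc)
  then have "R_A A * (v * R_semisimple) = 1 \<and> (v * R_semisimple) * R_A A = 1"
    by (simp add: R_A_factorization mult.assoc R_semisimple_square v)
  then show ?thesis by blast
qed

text \<open>The character kills every nonempty product of \<open>x\<close> generators, so only the
  semisimple factor is seen, with value \<open>(1 - 1 + g + g)/2\<close>.\<close>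

lemma slice_R_A:
  "slice_right counit_minus (R_A A) = gE" "slice_left counit_minus (R_A A) = gE"
proof -
  have half: "scaleE (1 / 2) u + scaleE (1 / 2) u = u" for u :: "('n, 'k) E"
    using two by (simp flip: E.scale_left_distrib)
  have um: "slice_right counit_minus (- T) = - slice_right counit_minus T"
    "slice_left counit_minus (- T) = - slice_left counit_minus T" for T :: "('n, 'k) EE"
    using slice_simps(6)[of counit_minus "- 1" T] slice_simps(3)[of counit_minus "- 1" T] by simp_all
  have t: "slice_right counit_minus (R_term i) = 0" "slice_left counit_minus (R_term i) = (0 :: ('n, 'k) E)"
    if "i \<in> R_index" for i
    proof -
    obtain P F where i: "i = (P, F)" by (cases i)
    then have "P \<noteq> {}" "F \<noteq> {}" using that by (simp_all add: R_index_def)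
    with i show "slice_right counit_minus (R_term i) = 0" "slice_left counit_minus (R_term i) = (0 :: ('n, 'k) E)"
      by (simp_all add: R_term_def counit_xE_prod)
  qed
  have "slice_right counit_minus (R_A A) = slice_right counit_minus (R_semisimple :: ('n, 'k) EE)"
    "slice_left counit_minus (R_A A) = slice_left counit_minus (R_semisimple :: ('n, 'k) EE)"
    by (simp_all add: R_A_factorization slice_right_mult slice_left_mult slice_sum t flip: tensor2_simps(6))
  then show "slice_right counit_minus (R_A A) = gE" "slice_left counit_minus (R_A A) = gE"
    by (simp_all add: R_semisimple_def diff_conv_add_uminus um E.scale_right_distrib half
        del: add_uminus_conv_diff)
qed

text \<open>
  Conjugation by \<open>R\<close> is only tractable on the subalgebra generated by the \<open>x\<^sub>i\<close>; modulo \<open>g\<close> this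
  is the whole of \<open>E(n)\<close>, and it is the subalgebra fixed by \<^term>\<open>sigma\<close>.
\<close>

lemma R_A_commute_odd:
  assumes "sigma d = d" "gE * d * gE = - d"
  shows "(1 \<otimes>\<^sub>k d) * R_A A = R_A A * (gE \<otimes>\<^sub>k d)"
proof -
  let ?R = "R_A A"
  \<comment> \<open>\<open>b + gE * b * gE\<close> and \<open>b - gE * b * gE\<close> are twice the
    even and the odd part of \<open>b\<close>. Moving \<open>1 \<otimes> b\<close> through
    \<open>R\<close> leaves the even part alone and attaches \<open>g\<close> to the odd part;
    \<open>J b\<close> is twice the result.\<close>
  define J where "J b = (1 \<otimes>\<^sub>k (b + gE * b * gE)) + (gE \<otimes>\<^sub>k (b - gE * b * gE))" for b :: "('n, 'k) E"
  have J_add: "J (b + b') = J b + J b'" for b b'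
    by (simp add: J_def distrib_left distrib_right tensor2_simps(2) tensor2_diff)
  have J_scale: "J (scaleE c b) = scaleEE c (J b)" for b c
    by (simp add: J_def E.scale_mult_left E.scale_mult_right tensor2_simps(2,4) tensor2_diff
        EE.scale_right_distrib EE.scale_right_diff_distrib)
  have J_x: "J (b * xE i) = J b * (gE \<otimes>\<^sub>k xE i)" for b i
    by (simp add: J_def mult.assoc distrib_right left_diff_distrib tensor2_mult E_rewrites)
  define K where "K b \<longleftrightarrow> sigma b = b \<and> scaleEE 2 ((1 \<otimes>\<^sub>k b) * ?R) = ?R * J b" for b
  have K_one: "K 1"
    using tensor2_simps(2)[of "1 :: ('n, 'k) E" 1 1] EE.scale_left_distrib[of 1 1 ?R]
    by (simp add: K_def J_def E_rewrites tensor2_simps(6) mult_2_right)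
  have K_add: "K (b + b')" if "K b" "K b'" for b b'
  proof -
    have "scaleEE 2 ((1 \<otimes>\<^sub>k (b + b')) * ?R) = scaleEE 2 ((1 \<otimes>\<^sub>k b) * ?R) + scaleEE 2 ((1 \<otimes>\<^sub>k b') * ?R)"
      by (simp add: tensor2_simps(2) distrib_right EE.scale_right_distrib)
    with that show ?thesis
      by (simp add: K_def J_add distrib_left)
  qed
  have K_scale: "K (scaleE c b)" if "K b" for b c
  proof -
    have "scaleEE 2 ((1 \<otimes>\<^sub>k scaleE c b) * ?R) = scaleEE c (scaleEE 2 ((1 \<otimes>\<^sub>k b) * ?R))"
      by (simp add: tensor2_simps(4) EE.scale_mult_left mult.commute)
    with that show ?thesis
      by (simp add: K_def J_scale EE.scale_mult_right)
  qed
  have K_zero: "K 0"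
    using K_scale[OF K_one, of 0] by simp
  have K_x: "K (b * xE i)" if "K b" for b i
  proof -
    have "scaleEE 2 ((1 \<otimes>\<^sub>k (b * xE i)) * ?R) = scaleEE 2 ((1 \<otimes>\<^sub>k b) * ?R) * (gE \<otimes>\<^sub>k xE i)"
      by (simp add: tensor2_mult mult.assoc EE.scale_mult_left flip: R_A_commute(2))
         (simp add: tensor2_mult flip: mult.assoc)
    with that show ?thesis
      by (simp add: K_def J_x mult.assoc)
  qed
  \<comment> \<open>\<open>K\<close> holds on the subalgebra generated by the \<open>x\<close>
    generators, and \<open>gE\<close> can always be collected on the right.\<close>
  have "\<exists>b b'. u = b + b' * gE \<and> K b \<and> K b'" for u
  proof (induction u rule: E_induct)
    case one
    show ?case using K_one K_zero by (intro exI[of _ 1] exI[of _ 0]) simp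
  next
    case (gen u a)
    then obtain b b' where u: "u = b + b' * gE" "K b" "K b'" by blast
    show ?case
    proof (cases a)
      case G
      then show ?thesis using u
        by (intro exI[of _ b'] exI[of _ b]) (simp add: distrib_right mult.assoc E_rewrites)
    next
      case (X i)
      then show ?thesis using u K_x[of b i] K_scale[OF K_x[of b' i], of "- 1"]
        by (intro exI[of _ "b * xE i"] exI[of _ "- (b' * xE i)"])
           (simp add: distrib_right mult.assoc E_rewrites)
    qed
  next
    case (add u v)
    then obtain b b' c c' where "u = b + b' * gE" "K b" "K b'" "v = c + c' * gE" "K c" "K c'" by blast
    then show ?case
      by (intro exI[of _ "b + c"] exI[of _ "b' + c'"]) (simp add: K_add distrib_right add_ac)
  next
    case (scale s u)
    then obtain b b' where "u = b + b' * gE" "K b" "K b'" by blast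
    then show ?case
      by (intro exI[of _ "scaleE s b"] exI[of _ "scaleE s b'"])
         (simp add: K_scale E.scale_right_distrib E.scale_mult_left)
  qed
  then obtain b b' where d: "d = b + b' * gE" "K b" "K b'" by blast
  \<comment> \<open>The left side is \<open>sigma d\<close>, as \<open>sigma\<close> fixes
    \<open>b\<close> and \<open>b'\<close> and negates \<open>gE\<close>. So the part of
    \<open>d\<close> containing \<open>gE\<close> vanishes and \<open>d\<close> itself satisfies
    \<open>K\<close>.\<close>
  then have "b - b' * gE = b + b' * gE"
    using assms(1) by (simp add: K_def)
  then have "scaleE 2 (b' * gE) = 0"
    using E.scale_left_distrib[of 1 1 "b' * gE"] by (simp add: algebra_simps)
  with two d have "K d" by simp
  then have "scaleEE 2 ((1 \<otimes>\<^sub>k d) * ?R) = ?R * (gE \<otimes>\<^sub>k (d + d))"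
    using assms(2) by (simp add: K_def J_def)
  also have "\<dots> = scaleEE 2 (?R * (gE \<otimes>\<^sub>k d))"
    using EE.scale_left_distrib[of 1 1 "?R * (gE \<otimes>\<^sub>k d)"] by (simp add: tensor2_simps(2) distrib_left)
  finally show ?thesis using two by simp
qed

end

section \<open>Slices of the coproduct and the joint kernel of the skew derivations\<close>

lemma slice_one:
  assumes "Vector_Spaces.linear scaleE (*) f"
  shows "slice_left f 1 = scaleE (f 1) 1" "slice_right f 1 = scaleE (f 1) 1"
  using slice_simps(1,4)[OF assms, of 1 1] by (simp_all only: tensor2_simps(6))

lemma slice_comult [simp]:
  "slice_left counit (comult u) = u" "slice_right counit (comult u) = u"
  "slice_left counit_minus (comult u) = theta u" "slice_right counit_minus (comult u) = sigma u"
proof -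
  note m = slice_left_mult[OF linear_simps(1)] slice_right_mult[OF linear_simps(1)]
    slice_left_mult[OF linear_simps(2)] slice_right_mult[OF linear_simps(2)]
  have "slice_left counit (comult u) = u \<and> slice_right counit (comult u) = u \<and>
    slice_left counit_minus (comult u) = theta u \<and> slice_right counit_minus (comult u) = sigma u"
  proof (induction u rule: E_induct)
    case (gen u a)
    then show ?case by (cases a) (simp_all add: comult_simps m)
  qed (simp_all add: comult_simps slice_one)
  then show "slice_left counit (comult u) = u" "slice_right counit (comult u) = u"
    "slice_left counit_minus (comult u) = theta u" "slice_right counit_minus (comult u) = sigma u"
    by simp_all
qed

lemma slice_left_coeff_x_mult:
  "slice_left (coeff_x i) (S * (a \<otimes>\<^sub>k b)) =
     scaleE (counit_minus a) (slice_left (coeff_x i) S * b) + scaleE (coeff_x i a) (slice_left counit S * b)"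
proof (induction S rule: EE_induct)
  case (scale c T)
  then show ?case
    by (simp add: EE.scale_mult_left E.scale_mult_left E.scale_right_distrib mult.commute)
next
  case (pure a b)
  then show ?case
    by (simp add: tensor2_mult E.scale_mult_left E.scale_left_distrib mult.commute)
qed (simp_all add: distrib_right E.scale_right_distrib add_ac)

text \<open>Both sides obey the same Leibniz rule and agree on generators. This is what turns the
  second hexagon axiom, evaluated at \<open>coeff_x i\<close>, into a statement about
  \<open>partial i\<close>.\<close>

lemma slice_coeff_x_comult [simp]: "slice_left (coeff_x i) (comult u) = partial i u"
proof (induction u rule: E_induct)
  case one
  show ?case by (simp add: comult_simps flip: tensor2_simps(6))
next
  case (gen u a)
  then show ?case
    by (cases a) (simp_all add: comult_simps distrib_left slice_left_coeff_x_mult)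
qed (simp_all add: comult_simps)

lemma map_left_decomposition:
  "T = map_left (diag True (\<lambda>j. if j = i then 0 else 1)) T + map_left (partial i) T * (xE i \<otimes>\<^sub>k 1)"
proof (induction T rule: EE_induct)
  case (add S T)
  then show ?case
    by (smt (verit, ccfv_SIG) add.assoc add.commute distrib_right linear_simps(4,5) map_simps(2))
next
  case (scale c T)
  then show ?case
    by (metis EE.scale_mult_left EE.scale_right_distrib linear_simps(4,5) map_simps(3))
next
  case (pure a b)
  show ?case
    by (subst partial_decomposition[of a i]) (simp add: tensor2_simps(1) tensor2_mult)
qed simp

text \<open>When \<open>partial i\<close> kills the first factor,
  \<open>map_left_decomposition\<close> says that setting \<open>xE i\<close> to zero does not
  change \<open>T\<close>. Doing this for all \<open>i\<close> leaves the span of \<open>1\<close>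
  and \<open>gE\<close> in the first factor, which the two characters detect.\<close>

lemma partial_kernel_EE:
  fixes T :: "('n::finite, 'k::field) EE"
  assumes two: "(2 :: 'k) \<noteq> 0"
    and "\<And>i. map_left (partial i) T = 0" "slice_left counit T = 0" "slice_left counit_minus T = 0"
  shows "T = 0"
proof -
  have comp: "map_left (diag True s) (map_left (diag True t) T) = map_left (diag True (\<lambda>i. s i * t i)) T"
    for s t :: "'n \<Rightarrow> 'k" and T
    by (induction T rule: EE_induct) (simp_all add: diag_diag)
  have "map_left (diag True (\<lambda>j. if j \<in> S then 0 else 1)) T = T" for S
  proof (induction S rule: finite_induct[OF finite])
    case 1
    have "map_left (diag True (\<lambda>_. 1)) T = T"
      by (induction T rule: EE_induct) (simp, simp, simp, subst map_simps(1)[OF linear_simps(4)], simp only: diag_one)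
    then show ?case by simp
  next
    case (2 i S)
    have "(\<lambda>j. if j \<in> insert i S then 0 else 1 :: 'k) = (\<lambda>j. (if j = i then 0 else 1) * (if j \<in> S then 0 else 1))"
      by auto
    then show ?case
      using map_left_decomposition[of T i] 2 by (simp add: assms comp[symmetric])
  qed
  from this[of UNIV] have T: "map_left (diag True (\<lambda>_. 0)) T = T" by simp
  \<comment> \<open>This is \<open>diag_zero\<close> in the first tensor factor: the projected
    tensor is recovered from its two character slices.\<close>
  have "scaleEE 2 (map_left (diag True (\<lambda>_. 0)) T) =
      (1 \<otimes>\<^sub>k (slice_left counit T + slice_left counit_minus T)) +
      (gE \<otimes>\<^sub>k (slice_left counit T - slice_left counit_minus T))" for T :: "('n, 'k) EE"
  proof (induction T rule: EE_induct)
    case (pure a b)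
    have "scaleEE 2 (map_left (diag True (\<lambda>_. 0)) (a \<otimes>\<^sub>k b)) = scaleE 2 (diag True (\<lambda>_. 0) a) \<otimes>\<^sub>k b"
      by (simp add: tensor2_simps(3))
    then show ?case
      by (simp add: diag_zero tensor2_simps(1-4) tensor2_diff EE.scale_left_distrib EE.scale_left_diff_distrib)
  next
    case (scale c T)
    have "scaleEE 2 (map_left (diag True (\<lambda>_. 0)) (scaleEE c T)) = scaleEE c (scaleEE 2 (map_left (diag True (\<lambda>_. 0)) T))"
      by (simp add: mult.commute)
    then show ?case
      by (simp add: scale tensor2_simps(2,4) tensor2_diff EE.scale_right_distrib EE.scale_right_diff_distrib)
  qed (simp_all add: EE.scale_right_distrib tensor2_simps(2) tensor2_diff)
  from this[of T] show ?thesis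
    using two by (simp add: T assms)
qed

lemma partial_kernel:
  fixes u :: "('n::finite, 'k::field) E"
  assumes "(2 :: 'k) \<noteq> 0" "\<And>i. partial i u = 0" "counit u = 0" "counit_minus u = 0"
  shows "u = 0"
proof -
  have "u \<otimes>\<^sub>k 1 = 0"
    by (rule partial_kernel_EE) (simp_all add: assms)
  then have "slice_right counit (u \<otimes>\<^sub>k 1) = 0" by simp
  then show ?thesis by simp
qed

lemma two_sided_inverse_eq:
  assumes "a * b = 1" "b * a = 1"
  shows "two_sided_inverse a = b"
  unfolding two_sided_inverse_def
proof (rule the_equality)
  show "c = b" if "a * c = 1 \<and> c * a = 1" for c
    using assms that by (metis mult.assoc mult_1_left mult_1_right)
qed (use assms in simp)

lemma tensor_sum:
  "(sum h I) \<otimes>\<^sub>k b = (\<Sum>i\<in>I. h i \<otimes>\<^sub>k b)" "b \<otimes>\<^sub>k (sum h I) = (\<Sum>i\<in>I. b \<otimes>\<^sub>k h i)"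
  by (induction I rule: infinite_finite_induct) (simp_all add: tensor2_simps(1,2))

lemma map_left_sum:
  assumes [simp]: "Vector_Spaces.linear scaleE scaleE f"
  shows "map_left f (sum h A) = (\<Sum>i\<in>A. map_left f (h i))"
  by (induction A rule: infinite_finite_induct) simp_all

lemma leg_sum:
  fixes h :: "'i \<Rightarrow> ('n, 'k::field) EE"
  shows "leg12 (sum h I) = (\<Sum>i\<in>I. leg12 (h i))" "leg13 (sum h I) = (\<Sum>i\<in>I. leg13 (h i))"
    "leg23 (sum h I) = (\<Sum>i\<in>I. leg23 (h i))" "id_comult (sum h I) = (\<Sum>i\<in>I. id_comult (h i))"
    "comult_id (sum h I) = (\<Sum>i\<in>I. comult_id (h i))" "flip (sum h I) = (\<Sum>i\<in>I. flip (h i))"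
proof -
  have "flip (0 :: ('n, 'k) EE) = 0" using flip_simps(2)[of 0 0] by simp
  then show "leg12 (sum h I) = (\<Sum>i\<in>I. leg12 (h i))" "leg13 (sum h I) = (\<Sum>i\<in>I. leg13 (h i))"
    "leg23 (sum h I) = (\<Sum>i\<in>I. leg23 (h i))" "id_comult (sum h I) = (\<Sum>i\<in>I. id_comult (h i))"
    "comult_id (sum h I) = (\<Sum>i\<in>I. comult_id (h i))" "flip (sum h I) = (\<Sum>i\<in>I. flip (h i))"
    by (induction I rule: infinite_finite_induct)
       (simp_all add: leg12_simps leg13_simps leg23_simps id_comult_simps comult_id_simps flip_simps)
qed

section \<open>Infinitesimal R-matrices of \<open>(E(n), R\<^sub>A)\<close>\<close>

definition chi_of :: "'k::field ^ 'n::finite ^ 'n \<Rightarrow> ('n, 'k) EE" where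
  "chi_of \<Gamma> = (\<Sum>p\<in>UNIV. \<Sum>q\<in>UNIV. scaleEE (\<Gamma> $ p $ q) (gE * xE p \<otimes>\<^sub>k xE q))"

lemma coeff_x_zero [simp]: "coeff_x i 0 = 0"
  using coeff_x_simps(2)[of i 0 0] by simp

lemma coeff_x_sum: "coeff_x i (sum h A) = (\<Sum>a\<in>A. coeff_x i (h a))"
  by (induction A rule: infinite_finite_induct) simp_all

text \<open>Provides a left inverse of \<open>chi_of\<close>, hence injectivity.\<close>

lemma coeff_chi_of: "coeff_x j (slice_left (coeff_x i) (chi_of \<Gamma>)) = \<Gamma> $ i $ j"
proof -
  have "coeff_x j (slice_left (coeff_x i) (chi_of \<Gamma>)) =
      (\<Sum>p\<in>UNIV. \<Sum>q\<in>UNIV. if i = p \<and> j = q then \<Gamma> $ p $ q else 0)"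
    unfolding chi_of_def by (auto simp: slice_sum coeff_x_sum intro!: sum.cong)
  also have "\<dots> = (\<Sum>p\<in>UNIV. if i = p then \<Gamma> $ p $ j else 0)"
    by (intro sum.cong) (auto simp: sum.delta)
  finally show ?thesis by simp
qed

lemma chi_of_add: "chi_of \<Gamma> + chi_of \<Delta> = chi_of (\<Gamma> + \<Delta>)"
  by (simp add: chi_of_def sum.distrib EE.scale_left_distrib)

lemma chi_of_eq_0_iff: "chi_of \<Gamma> = 0 \<longleftrightarrow> \<Gamma> = 0"
proof
  assume "chi_of \<Gamma> = 0"
  then have "\<Gamma> $ i $ j = 0" for i j
    using coeff_chi_of[of j i \<Gamma>] by simp
  then show "\<Gamma> = 0" by (simp add: Finite_Cartesian_Product.vec_eq_iff)
qed (simp add: chi_of_def)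

lemma subspace_range_chi_of: "EE.subspace (range (chi_of :: 'k::field ^ 'n::finite ^ 'n \<Rightarrow> _))"
proof (rule EE.subspaceI)
  show "0 \<in> range (chi_of :: 'k ^ 'n ^ 'n \<Rightarrow> _)"
    using chi_of_eq_0_iff[of "0 :: 'k ^ 'n ^ 'n"] by (metis rangeI)
next
  fix S T :: "('n, 'k) EE" and c :: 'k
  assume S: "S \<in> range chi_of"
  then obtain \<Gamma> where \<Gamma>: "S = chi_of \<Gamma>" by auto
  have "scaleEE c S = chi_of (vec_lambda (\<lambda>p. vec_lambda (\<lambda>q. c * \<Gamma> $ p $ q)))"
    by (simp add: \<Gamma> chi_of_def EE.scale_sum_right)
  then show "scaleEE c S \<in> range chi_of" by blast
  assume "T \<in> range chi_of"
  with S show "S + T \<in> range chi_of" by (auto simp: chi_of_add)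
qed

lemma dim_range_chi_of: "EE.dim (range (chi_of :: 'k::field ^ 'n::finite ^ 'n \<Rightarrow> _)) = CARD('n) ^ 2"
proof -
  let ?V = "range (chi_of :: 'k ^ 'n ^ 'n \<Rightarrow> _)"
  define t :: "'n \<times> 'n \<Rightarrow> ('n, 'k) EE" where "t = (\<lambda>(p, q). (gE * xE p) \<otimes>\<^sub>k xE q)"
  let ?B = "t ` UNIV"
  \<comment> \<open>These functionals form a dual family to the tensors \<open>t j\<close>; they
    give injectivity of \<open>t\<close> and linear independence at once.\<close>
  let ?K = "\<lambda>i T. coeff_x (snd i) (slice_left (coeff_x (fst i)) T) :: 'k"
  have K: "?K i (t j) = (if i = j then 1 else 0)" for i j :: "'n \<times> 'n"
    by (auto simp: t_def case_prod_unfold prod_eq_iff)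
  have inj: "inj t"
  proof (rule injI)
    fix i j assume "t i = t j"
    then have "?K i (t i) = ?K i (t j)" by simp
    then show "i = j" unfolding K by (simp split: if_splits)
  qed
  have indep: "EE.independent ?B"
  proof (rule EE.independent_if_scalars_zero)
    fix f :: "('n, 'k) EE \<Rightarrow> 'k" and v
    assume sum: "(\<Sum>x\<in>?B. scaleEE (f x) x) = 0" and "v \<in> ?B"
    then obtain i where i: "v = t i" by blast
    have "0 = ?K i (\<Sum>x\<in>?B. scaleEE (f x) x)"
      unfolding sum by simp
    also have "\<dots> = (\<Sum>j\<in>UNIV. f (t j) * ?K i (t j))"
      by (simp add: sum.reindex[OF inj] slice_sum coeff_x_sum del: coeff_x_simps(3))
    also have "\<dots> = f v"
      unfolding K by (simp add: i if_distrib[of "(*) _"] cong: if_cong)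
    finally show "f v = 0" by simp
  qed simp
  have "t (p, q) \<in> ?V" for p q
  proof -
    have "chi_of (vec_lambda (\<lambda>p'. vec_lambda (\<lambda>q'. if p' = p \<and> q' = q then 1 else 0 :: 'k))) =
      (\<Sum>p'\<in>UNIV. \<Sum>q'\<in>UNIV. if p' = p \<and> q' = q then (gE * xE p') \<otimes>\<^sub>k xE q' else 0)"
      unfolding chi_of_def by (intro sum.cong) auto
    also have "\<dots> = (\<Sum>p'\<in>UNIV. if p' = p then (gE * xE p') \<otimes>\<^sub>k xE q else 0)"
      by (intro sum.cong) (auto simp: sum.delta')
    also have "\<dots> = t (p, q)"
      by (simp add: t_def)
    finally show ?thesis by (rule range_eqI[OF sym])
  qed
  then have B: "?B \<subseteq> ?V" by auto
  have "chi_of \<Gamma> \<in> EE.span ?B" for \<Gamma> :: "'k ^ 'n ^ 'n"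
    unfolding chi_of_def by (intro EE.span_sum EE.span_scale EE.span_base) (auto simp: t_def image_def)
  then have "?V \<subseteq> EE.span ?B" by auto
  moreover have "?B \<subseteq> EE.span ?V"
    using B EE.span_superset by blast
  ultimately have "EE.span ?B = EE.span ?V"
    by (simp only: EE.span_eq)
  then have "EE.dim ?V = card ?B"
    using EE.dim_eq_card indep by metis
  also have "\<dots> = CARD('n) ^ 2"
    using card_image[OF inj] by (simp add: power2_eq_square)
  finally show ?thesis .
qed

section \<open>Sufficiency and the Cartier criterion\<close>

abbreviation flip_index :: "'k ^ 'n ^ 'n \<Rightarrow> 'k ^ 'n ^ 'n" where
  "flip_index \<Gamma> \<equiv> vec_lambda (\<lambda>p. vec_lambda (\<lambda>q. \<Gamma> $ q $ p))"

text \<open>The condition is multiplicative in \<open>h\<close>, so generators suffice. There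
  \<open>gE * xE p\<close> commutes with \<open>xE i\<close> and anticommutes with
  \<open>gE\<close>, while \<open>xE q\<close> anticommutes with both, so the signs cancel in each
  summand of the coproduct.\<close>

lemma chi_of_central:
  fixes \<Gamma> :: "'k::field ^ 'n::finite ^ 'n"
  shows "chi_of \<Gamma> * comult h = comult h * chi_of \<Gamma>"
proof (induction h rule: E_induct)
  case (gen u a)
  have x: "xE i * xE j = - (xE j * xE i :: ('n, 'k) E)" for i j by (rule E_relations)
  have "((gE * xE p) \<otimes>\<^sub>k xE q) * comult (E_gen a) = (comult (E_gen a) * ((gE * xE p) \<otimes>\<^sub>k xE q) :: ('n, 'k) EE)"
    for p q
  proof (cases a)
    case (X i)
    then show ?thesis
      by (simp add: comult_simps distrib_left distrib_right tensor2_mult mult.assoc E_rewrites x[of p i] x[of q i] add_ac)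
  qed (simp add: comult_simps tensor2_mult mult.assoc E_rewrites)
  then have eq: "chi_of \<Gamma> * comult (E_gen a) = comult (E_gen a) * chi_of \<Gamma>"
    by (simp add: chi_of_def sum_distrib_left sum_distrib_right EE.scale_mult_left EE.scale_mult_right)
  have "chi_of \<Gamma> * comult (u * E_gen a) = (chi_of \<Gamma> * comult u) * comult (E_gen a)"
    by (simp only: comult_simps(2) mult.assoc)
  also have "\<dots> = comult u * (chi_of \<Gamma> * comult (E_gen a))"
    by (simp only: gen mult.assoc)
  also have "\<dots> = comult (u * E_gen a) * chi_of \<Gamma>"
    by (simp only: eq comult_simps(2) mult.assoc)
  finally show ?case .
qed (simp_all add: comult_simps distrib_left distrib_right EE.scale_mult_left EE.scale_mult_right)

context
  fixes A :: "'k::field ^ 'n::{finite, linorder} ^ 'n::{finite, linorder}" and R' :: "('n, 'k) EE"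
  assumes two: "(2 :: 'k) \<noteq> 0"
    and inverse: "R_A A * R' = 1" "R' * R_A A = 1"
begin

lemma inverse_cancel: "R_A A * (R' * T) = T" "R' * (R_A A * T) = T"
  by (simp_all add: inverse flip: mult.assoc)

lemma two_sided_inverse_leg:
  "two_sided_inverse (leg12 (R_A A)) = leg12 R'" "two_sided_inverse (leg23 (R_A A)) = leg23 R'"
  by (rule two_sided_inverse_eq; simp add: inverse leg12_simps(4) leg23_simps(4) flip: leg12_simps(2) leg23_simps(2))+

text \<open>The third leg is untouched by \<open>leg12\<close>, and \<open>R_A_commute\<close>
  conjugates \<open>gE * xE p \<otimes> 1\<close> into \<open>gE * xE p \<otimes> gE\<close>. The
  element \<open>d\<close> is arbitrary, which matters when \<open>comult_d\<close> is
  derived.\<close>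

lemma conj_leg12:
  "leg12 R' * leg13 ((gE * xE p) \<otimes>\<^sub>k d) * leg12 (R_A A) = tensor3 (gE * xE p) gE d"
proof -
  have "leg13 ((gE * xE p) \<otimes>\<^sub>k d) = leg12 ((gE * xE p) \<otimes>\<^sub>k 1) * tensor3 1 1 d"
    by (simp add: leg13_pure leg12_simps flip: tensor3_simps(7))
  then have "leg12 R' * leg13 ((gE * xE p) \<otimes>\<^sub>k d) * leg12 (R_A A) =
      leg12 (R' * (((gE * xE p) \<otimes>\<^sub>k 1) * R_A A)) * tensor3 1 1 d"
    by (simp add: leg12_simps(2) mult.assoc leg12_commute[symmetric])
  then show ?thesis
    by (simp add: R_A_commute inverse_cancel leg12_simps(5) flip: tensor3_simps(7))
qed

lemma conj_leg23:
  "leg23 R' * leg13 (c \<otimes>\<^sub>k xE q) * leg23 (R_A A) = tensor3 c gE (xE q)"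
proof -
  have "leg13 (c \<otimes>\<^sub>k xE q) = tensor3 c 1 1 * leg23 (1 \<otimes>\<^sub>k xE q)"
    by (simp add: leg13_pure leg23_simps flip: tensor3_simps(7))
  then have "leg23 R' * leg13 (c \<otimes>\<^sub>k xE q) * leg23 (R_A A) =
      tensor3 c 1 1 * leg23 (R' * ((1 \<otimes>\<^sub>k xE q) * R_A A))"
    by (simp add: leg23_simps(2) leg23_commute flip: mult.assoc)
  then show ?thesis
    by (simp add: R_A_commute inverse_cancel leg23_simps(5) flip: tensor3_simps(7))
qed

text \<open>Once the conjugations are computed, the two hexagon axioms are the coproduct formulas of
  the skew primitive elements \<open>xE q\<close> and \<open>gE * xE p\<close>.\<close>

lemma infinitesimal_chi_of: "infinitesimal_R_matrix (R_A A) (chi_of \<Gamma>)"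
proof -
  note s = leg_sum leg12_simps(3) leg13_simps(2) leg23_simps(3) id_comult_simps(2) comult_id_simps(2)
    sum_distrib_left sum_distrib_right EEE.scale_mult_left EEE.scale_mult_right EEE.scale_right_distrib
  have 1: "id_comult ((gE * xE p) \<otimes>\<^sub>k xE q) = tensor3 (gE * xE p) (xE q) 1 + tensor3 (gE * xE p) gE (xE q)"
    for p q :: 'n
    by (simp add: id_comult_simps comult_simps leg23_simps distrib_left flip: tensor3_simps(7))
  have 2: "comult_id ((gE * xE p) \<otimes>\<^sub>k xE q) = tensor3 1 (gE * xE p) (xE q) + tensor3 (gE * xE p) gE (xE q)"
    for p q :: 'n
    by (simp add: comult_id_simps comult_simps leg12_simps distrib_left distrib_right tensor2_mult E_rewrites add_ac
        flip: tensor3_simps(7))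
  have "id_comult (chi_of \<Gamma>) = leg12 (chi_of \<Gamma>) + leg12 R' * leg13 (chi_of \<Gamma>) * leg12 (R_A A)"
    unfolding chi_of_def s conj_leg12 1 leg12_simps(5) by (simp add: sum.distrib)
  moreover have "comult_id (chi_of \<Gamma>) = leg23 (chi_of \<Gamma>) + leg23 R' * leg13 (chi_of \<Gamma>) * leg23 (R_A A)"
    unfolding chi_of_def s conj_leg23 2 leg23_simps(5) by (simp add: sum.distrib)
  ultimately show ?thesis
    by (simp add: infinitesimal_R_matrix_def two_sided_inverse_leg chi_of_central)
qed

lemma flip_chi_of: "flip (chi_of \<Gamma>) * R_A A = - (R_A A * chi_of (flip_index \<Gamma>))"
proof -
  have 1: "(xE q \<otimes>\<^sub>k (gE * xE p)) * R_A A = - (R_A A * ((gE * xE q) \<otimes>\<^sub>k xE p))" for p q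
  proof -
    \<comment> \<open>The tensor is split into three factors, each of which has its own rule in
      \<open>R_A_commute\<close>; the final sign comes from \<open>xE q\<close> passing
      \<open>gE\<close>.\<close>
    have "(xE q \<otimes>\<^sub>k (gE * xE p)) * R_A A = (gE \<otimes>\<^sub>k gE) * (((gE * xE q) \<otimes>\<^sub>k 1) * ((1 \<otimes>\<^sub>k xE p) * R_A A))"
      by (simp add: tensor2_mult E_rewrites flip: mult.assoc)
    also have "\<dots> = (gE \<otimes>\<^sub>k gE) * ((((gE * xE q) \<otimes>\<^sub>k 1) * R_A A) * (gE \<otimes>\<^sub>k xE p))"
      by (simp only: R_A_commute(2) mult.assoc)
    also have "\<dots> = (gE \<otimes>\<^sub>k gE) * ((R_A A * ((gE * xE q) \<otimes>\<^sub>k gE)) * (gE \<otimes>\<^sub>k xE p))"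
      by (simp only: R_A_commute(1))
    also have "\<dots> = ((gE \<otimes>\<^sub>k gE) * R_A A) * (((gE * xE q) \<otimes>\<^sub>k gE) * (gE \<otimes>\<^sub>k xE p))"
      by (simp only: mult.assoc)
    also have "\<dots> = (R_A A * (gE \<otimes>\<^sub>k gE)) * (((gE * xE q) \<otimes>\<^sub>k gE) * (gE \<otimes>\<^sub>k xE p))"
      by (simp only: R_A_commute(3))
    also have "\<dots> = - (R_A A * ((gE * xE q) \<otimes>\<^sub>k xE p))"
      by (simp add: tensor2_mult E_rewrites mult.assoc)
    finally show ?thesis .
  qed
  have "flip (chi_of \<Gamma>) * R_A A = (\<Sum>p\<in>UNIV. \<Sum>q\<in>UNIV. scaleEE (\<Gamma> $ p $ q) (- (R_A A * ((gE * xE q) \<otimes>\<^sub>k xE p))))"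
    by (simp add: chi_of_def leg_sum flip_simps flip_pure sum_distrib_right EE.scale_mult_left 1)
  also have "\<dots> = - (\<Sum>p\<in>UNIV. \<Sum>q\<in>UNIV. scaleEE (\<Gamma> $ p $ q) (R_A A * ((gE * xE q) \<otimes>\<^sub>k xE p)))"
    by (simp add: sum_negf)
  also have "\<dots> = - (\<Sum>q\<in>UNIV. \<Sum>p\<in>UNIV. scaleEE (\<Gamma> $ p $ q) (R_A A * ((gE * xE q) \<otimes>\<^sub>k xE p)))"
    by (subst sum.swap) (rule refl)
  also have "\<dots> = - (R_A A * chi_of (flip_index \<Gamma>))"
    by (simp add: chi_of_def sum_distrib_left EE.scale_mult_right)
  finally show ?thesis .
qed

text \<open>By \<open>flip_chi_of\<close> the Cartier equation says that \<open>R_A A\<close>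
  annihilates \<open>chi_of\<close> of the sum of the matrix and its transpose; \<open>R_A A\<close>
  is invertible and \<open>chi_of\<close> is injective.\<close>

lemma cartier_chi_of: "cartier (R_A A) (chi_of \<Gamma>) \<longleftrightarrow> (\<forall>p q. \<Gamma> $ p $ q = - (\<Gamma> $ q $ p))"
proof -
  have "cartier (R_A A) (chi_of \<Gamma>) \<longleftrightarrow> R_A A * chi_of \<Gamma> + R_A A * chi_of (flip_index \<Gamma>) = 0"
    by (simp add: cartier_def infinitesimal_chi_of flip_chi_of eq_neg_iff_add_eq_0)
  also have "\<dots> \<longleftrightarrow> R_A A * chi_of (\<Gamma> + flip_index \<Gamma>) = 0"
    by (simp only: chi_of_add[symmetric] distrib_left)
  also have "\<dots> \<longleftrightarrow> chi_of (\<Gamma> + flip_index \<Gamma>) = 0"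
    using inverse_cancel(2)[of "chi_of (\<Gamma> + flip_index \<Gamma>)"] by (metis mult_zero_right)
  also have "\<dots> \<longleftrightarrow> (\<forall>p q. \<Gamma> $ p $ q = - (\<Gamma> $ q $ p))"
    unfolding chi_of_eq_0_iff by (simp add: Finite_Cartesian_Product.vec_eq_iff eq_neg_iff_add_eq_0)
  finally show ?thesis .
qed

end

section \<open>Necessity: every infinitesimal R-matrix has the stated form\<close>

lemma map_id:
  "map_left (\<lambda>u. u) T = T" "map_right (\<lambda>u. u) T = T"
proof -
  have [simp]: "Vector_Spaces.linear scaleE scaleE (\<lambda>u :: ('a, 'b) E. u)"
    by (simp add: E.linear_iffE)
  show "map_left (\<lambda>u. u) T = T" "map_right (\<lambda>u. u) T = T"
    by (induction T rule: EE_induct) simp_all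
qed

text \<open>The character \<open>counit_minus\<close> has order two under convolution, so
  contracting with it twice gives the counit.\<close>

lemma slice_map_character:
  "slice_right counit_minus (map_right sigma T) = slice_right counit T"
  "slice_left counit_minus (map_left theta T) = slice_left counit T"
  by (induction T rule: EE_induct) simp_all

lemma slice_left_coeff_x_g_mult:
  "slice_left (coeff_x i) ((gE \<otimes>\<^sub>k b) * T) = b * slice_left (coeff_x i) T"
  by (induction T rule: EE_induct)
     (simp_all add: distrib_left EE.scale_mult_right E.scale_mult_right tensor2_mult)

lemma eq_0_if_add_self:
  fixes u :: "('n, 'k::field) E"
  assumes "(2 :: 'k) \<noteq> 0" "u + u = 0"
  shows "u = 0"
proof -
  have "scaleE 2 u = 0"
    using assms(2) E.scale_left_distrib[of 1 1 u] by simp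
  with assms(1) show ?thesis by simp
qed

context
  fixes A :: "'k::field ^ 'n::{finite, linorder} ^ 'n::{finite, linorder}" and R' \<chi> :: "('n, 'k) EE"
  assumes two: "(2 :: 'k) \<noteq> 0"
    and inverse: "R_A A * R' = 1" "R' * R_A A = 1"
    and inf: "infinitesimal_R_matrix (R_A A) \<chi>"
begin

private lemma axioms:
  "\<chi> * comult h = comult h * \<chi>"
  "id_comult \<chi> = leg12 \<chi> + leg12 R' * leg13 \<chi> * leg12 (R_A A)"
  "comult_id \<chi> = leg23 \<chi> + leg23 R' * leg13 \<chi> * leg23 (R_A A)"
  using inf by (auto simp: infinitesimal_R_matrix_def two_sided_inverse_leg[OF two inverse])

text \<open>This is the first hexagon axiom with its third leg evaluated at \<open>f\<close>;
  \<open>h\<close> is the contraction of the coproduct with \<open>f\<close>.\<close>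

private lemma map_right_eq:
  assumes [simp]: "Vector_Spaces.linear scaleE (*) f" "Vector_Spaces.linear scaleE scaleE h"
    and "\<And>a. slice_right f (comult a) = h a"
  shows "map_right h \<chi> = scaleEE (f 1) \<chi> + R' * (slice_right f \<chi> \<otimes>\<^sub>k 1) * R_A A"
proof -
  have "map_right h \<chi> = slice3_right f (id_comult \<chi>)"
    by (rule slice3_right_id_comult[symmetric]) (use assms in auto)
  then show ?thesis
    by (simp add: axioms(2) slice3_leg slice3_right_conj)
qed

private lemma map_left_eq:
  assumes [simp]: "Vector_Spaces.linear scaleE (*) f" "Vector_Spaces.linear scaleE scaleE h"
    and "\<And>a. slice_left f (comult a) = h a"
  shows "map_left h \<chi> = scaleEE (f 1) \<chi> + R' * (1 \<otimes>\<^sub>k slice_left f \<chi>) * R_A A"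
proof -
  have "map_left h \<chi> = slice3_left f (comult_id \<chi>)"
    by (rule slice3_left_comult_id[symmetric]) (use assms in auto)
  then show ?thesis
    by (simp add: axioms(3) slice3_leg slice3_left_conj)
qed

private lemma conj_eq_0: "R' * T * R_A A = 0 \<Longrightarrow> T = 0"
proof -
  assume "R' * T * R_A A = 0"
  then have "R_A A * (R' * T * R_A A) * R' = 0" by simp
  then show "T = 0"
    by (simp add: mult.assoc inverse) (simp add: inverse flip: mult.assoc)
qed

private lemma slice_inverse:
  "slice_right counit_minus R' = gE" "slice_left counit_minus R' = gE"
proof -
  have "gE * slice_right counit_minus R' = 1" "gE * slice_left counit_minus R' = 1"
    using slice_right_mult[of counit_minus "R_A A" R'] slice_left_mult[of counit_minus "R_A A" R']
    by (simp_all add: inverse slice_one slice_R_A[OF two])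
  then show "slice_right counit_minus R' = gE" "slice_left counit_minus R' = gE"
    by (metis E_rewrites(2) mult_1_right)+
qed

text \<open>At the counit the contraction \<open>h\<close> is the identity, so \<open>\<chi>\<close>
  cancels from both sides and the conjugate of the slice must vanish.\<close>

private lemma slice_counit: "slice_right counit \<chi> = 0" "slice_left counit \<chi> = 0"
proof -
  have lin: "Vector_Spaces.linear scaleE scaleE (\<lambda>u :: ('n, 'k) E. u)"
    by (simp add: E.linear_iffE)
  have "slice_right counit \<chi> \<otimes>\<^sub>k 1 = 0"
  proof (rule conj_eq_0)
    show "R' * (slice_right counit \<chi> \<otimes>\<^sub>k 1) * R_A A = 0"
      using map_right_eq[OF linear_simps(1) lin slice_comult(2)]
      by (simp only: map_id counit_simps(1) EE.scale_one add_cancel_right_right)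
  qed
  then have "slice_right counit (slice_right counit \<chi> \<otimes>\<^sub>k 1) = 0" by simp
  then show "slice_right counit \<chi> = 0" by simp
  have "1 \<otimes>\<^sub>k slice_left counit \<chi> = 0"
  proof (rule conj_eq_0)
    show "R' * (1 \<otimes>\<^sub>k slice_left counit \<chi>) * R_A A = 0"
      using map_left_eq[OF linear_simps(1) lin slice_comult(1)]
      by (simp only: map_id counit_simps(1) EE.scale_one add_cancel_right_right)
  qed
  then have "slice_left counit (1 \<otimes>\<^sub>k slice_left counit \<chi>) = 0" by simp
  then show "slice_left counit \<chi> = 0" by simp
qed

text \<open>
  Evaluating the hexagon axioms at the character \<open>g \<mapsto> - 1\<close> shows that these slices anticommute
  with \<open>g\<close>, whereas centrality of \<open>g \<otimes> g\<close> shows that they commute with \<open>g\<close>.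
\<close>

private lemma slice_counit_minus: "slice_right counit_minus \<chi> = 0" "slice_left counit_minus \<chi> = 0"
proof -
  have gg: "\<chi> * (gE \<otimes>\<^sub>k gE) = (gE \<otimes>\<^sub>k gE) * \<chi>"
    using axioms(1)[of gE] by (simp add: comult_simps)
  let ?U = "slice_right counit_minus \<chi>" and ?W = "slice_left counit_minus \<chi>"
  \<comment> \<open>The axiom at \<open>counit_minus\<close> is sliced once more at
    \<open>counit_minus\<close>: conjugation by \<open>R\<close> becomes conjugation by
    \<open>gE\<close>, and the left side becomes the counit slice, already known to be zero.\<close>
  have "slice_right counit_minus (map_right sigma \<chi>) = ?U + gE * ?U * gE"
    by (subst map_right_eq[of counit_minus])
       (simp_all add: slice_right_mult slice_inverse slice_R_A[OF two])
  then have "?U + gE * ?U * gE = 0"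
    by (simp add: slice_map_character slice_counit)
  moreover have "?U * gE = gE * ?U"
    using arg_cong[OF gg, of "slice_right counit_minus"] by (simp add: slice_right_mult)
  ultimately have "?U + ?U = 0"
    by (simp add: mult.assoc E_rewrites)
  then show "?U = 0"
    by (rule eq_0_if_add_self[OF two])
  have "slice_left counit_minus (map_left theta \<chi>) = ?W + gE * ?W * gE"
    by (subst map_left_eq[of counit_minus])
       (simp_all add: slice_left_mult slice_inverse slice_R_A[OF two])
  then have "?W + gE * ?W * gE = 0"
    by (simp add: slice_map_character slice_counit)
  moreover have "?W * gE = gE * ?W"
    using arg_cong[OF gg, of "slice_left counit_minus"] by (simp add: slice_left_mult)
  ultimately have "?W + ?W = 0"
    by (simp add: mult.assoc E_rewrites)
  then show "?W = 0"
    by (rule eq_0_if_add_self[OF two])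
qed

private definition d :: "'n \<Rightarrow> ('n, 'k) E" where
  "d i = slice_left (coeff_x i) \<chi>"

text \<open>Since the slice at \<open>counit_minus\<close> vanishes, the first axiom at this
  character reduces to invariance of \<open>\<chi>\<close> under \<open>sigma\<close> in the second
  factor.\<close>

private lemma d_sigma: "sigma (d i) = d i"
proof -
  have "map_right sigma \<chi> = \<chi>"
    using map_right_eq[of counit_minus sigma] by (simp add: slice_counit_minus)
  then show ?thesis
    using slice_left_map_right[of "coeff_x i" sigma \<chi>] by (simp add: d_def)
qed

text \<open>Multiplying by \<open>gE\<close> on the right changes the sign of
  \<open>coeff_x i\<close>, on the left it does not; \<open>\<chi>\<close> commutes with
  \<open>gE \<otimes> gE\<close>.\<close>

private lemma d_odd: "gE * d i * gE = - d i"
proof -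
  have "\<chi> * (gE \<otimes>\<^sub>k gE) = (gE \<otimes>\<^sub>k gE) * \<chi>"
    using axioms(1)[of gE] by (simp add: comult_simps)
  then have "- (d i * gE) = gE * d i"
    using slice_left_coeff_x_mult[of i \<chi> gE gE] slice_left_coeff_x_g_mult[of i gE \<chi>] by (simp add: d_def)
  then have "gE * d i * gE = - (d i * gE) * gE" by simp
  then show ?thesis by (simp add: mult.assoc E_rewrites)
qed

text \<open>\<open>coeff_x i\<close> vanishes at \<open>1\<close>, so in the second axiom only the
  conjugated term remains, and \<open>d i\<close> satisfies the hypotheses of
  \<open>R_A_commute_odd\<close>.\<close>

private lemma partial_chi: "map_left (partial i) \<chi> = gE \<otimes>\<^sub>k d i"
proof -
  have "map_left (partial i) \<chi> = R' * ((1 \<otimes>\<^sub>k d i) * R_A A)"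
    using map_left_eq[of "coeff_x i" "partial i"] by (simp add: d_def mult.assoc)
  then show ?thesis
    by (simp add: R_A_commute_odd[OF two d_sigma d_odd] inverse_cancel[OF two inverse])
qed

text \<open>\<open>partial i\<close> sends \<open>gE * xE p\<close> to \<open>gE\<close> for
  \<open>p = i\<close> and to \<open>0\<close> otherwise, and both characters kill it. So the
  difference of the two sides lies in the joint kernel.\<close>

private lemma chi_expansion: "\<chi> = (\<Sum>p\<in>UNIV. (gE * xE p) \<otimes>\<^sub>k d p)"
proof -
  let ?S = "\<Sum>p\<in>UNIV. (gE * xE p) \<otimes>\<^sub>k d p"
  have "\<chi> - ?S = 0"
  proof (rule partial_kernel_EE[OF two])
    fix i
    have "map_left (partial i) ?S = (\<Sum>p\<in>UNIV. if p = i then gE \<otimes>\<^sub>k d i else 0)"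
      unfolding map_left_sum[OF linear_simps(5)] by (intro sum.cong) auto
    then show "map_left (partial i) (\<chi> - ?S) = 0"
      by (simp add: partial_chi)
  qed (simp_all add: slice_counit slice_counit_minus slice_sum)
  then show ?thesis by simp
qed

text \<open>The first axiom is evaluated at \<open>coeff_x j\<close> in the first leg. The expansion
  of \<open>\<chi>\<close> makes its conjugated term computable by
  \<open>conj_leg12\<close>.\<close>

private lemma comult_d: "comult (d j) = (d j \<otimes>\<^sub>k 1) + (gE \<otimes>\<^sub>k d j)"
proof -
  have sum: "slice3_left (coeff_x j) (sum h I) = (\<Sum>i\<in>I. slice3_left (coeff_x j) (h i))"
    for h :: "'n \<Rightarrow> ('n, 'k) EEE" and I
    by (induction I rule: infinite_finite_induct) simp_all
  have conj: "leg12 R' * leg13 \<chi> * leg12 (R_A A) = (\<Sum>p\<in>UNIV. tensor3 (gE * xE p) gE (d p))"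
    by (subst (1) chi_expansion)
       (simp add: leg_sum sum_distrib_left sum_distrib_right conj_leg12[OF two inverse])
  have "slice3_left (coeff_x j) (leg12 R' * leg13 \<chi> * leg12 (R_A A)) =
      (\<Sum>p\<in>UNIV. if p = j then gE \<otimes>\<^sub>k d j else 0)"
    unfolding conj sum by (intro sum.cong) auto
  then show ?thesis
    using arg_cong[OF axioms(2), of "slice3_left (coeff_x j)"]
    by (simp add: slice3_left_id_comult slice3_leg d_def[symmetric])
qed

text \<open>Skew primitivity makes every \<open>partial i (d j)\<close> a scalar, which the linear
  combination of the \<open>xE q\<close> reproduces. Conjugation by \<open>gE\<close> preserves both
  characters but negates \<open>d j\<close>, so they vanish on it.\<close>

private lemma d_expansion: "d j = (\<Sum>q\<in>UNIV. scaleE (coeff_x q (d j)) (xE q))"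
proof -
  let ?S = "\<Sum>q\<in>UNIV. scaleE (coeff_x q (d j)) (xE q)"
  have lin: "f (sum h I) = (\<Sum>i\<in>I. f (h i))"
    if "f 0 = 0" "\<And>u v. f (u + v) = f u + f v"
    for f :: "('n, 'k) E \<Rightarrow> 'r::comm_monoid_add" and h :: "'n \<Rightarrow> _" and I
    by (induction I rule: infinite_finite_induct) (simp_all add: that)
  have p0: "partial i 0 = (0 :: ('n, 'k) E)" for i
    using partial_simps(2)[of i 0 0] by simp
  have "d j - ?S = 0"
  proof (rule partial_kernel[OF two])
    fix i
    have "partial i (d j) = scaleE (coeff_x i (d j)) 1"
      using slice_coeff_x_comult[of i "d j"] by (simp add: comult_d)
    moreover have "partial i ?S = (\<Sum>q\<in>UNIV. if q = i then scaleE (coeff_x i (d j)) 1 else 0)"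
      unfolding lin[of "partial i", OF p0 partial_simps(1)] by (intro sum.cong) auto
    ultimately show "partial i (d j - ?S) = 0"
      by simp
  next
    have "counit (gE * d j * gE) = - counit (d j)"
      by (simp add: d_odd)
    then have "2 * counit (d j) = 0" by simp
    with two show "counit (d j - ?S) = 0"
      by (simp add: lin[of counit])
  next
    have "counit_minus (gE * d j * gE) = - counit_minus (d j)"
      by (simp add: d_odd)
    then have "2 * counit_minus (d j) = 0" by simp
    moreover have "counit_minus (0 :: ('n, 'k) E) = 0"
      using counit_minus_simps(4)[of 0 0] by simp
    ultimately show "counit_minus (d j - ?S) = 0"
      using two by (simp add: lin[of counit_minus])
  qed
  then show ?thesis by simp
qed

lemma infinitesimal_R_matrix_in_range: "\<chi> \<in> range chi_of"
proof -
  have "\<chi> = (\<Sum>p\<in>UNIV. (gE * xE p) \<otimes>\<^sub>k (\<Sum>q\<in>UNIV. scaleE (coeff_x q (d p)) (xE q)))"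
    by (simp only: chi_expansion[symmetric] d_expansion[symmetric])
  then have "\<chi> = chi_of (vec_lambda (\<lambda>p. vec_lambda (\<lambda>q. coeff_x q (d p))))"
    by (simp add: chi_of_def tensor_sum tensor2_simps(4))
  then show ?thesis by (rule range_eqI)
qed

end

theorem theorem4p28:
  fixes A :: "'k::field ^ 'n::{finite, linorder} ^ 'n::{finite, linorder}"
  assumes "CHAR('k) \<noteq> 2"
  shows
    "(\<forall>\<chi> :: ('n, 'k) EE.
        infinitesimal_R_matrix (R_A A) \<chi> \<longleftrightarrow>
        (\<exists>\<Gamma> :: 'k ^ 'n::{finite, linorder} ^ 'n::{finite, linorder}.
           \<chi> = (\<Sum>p\<in>UNIV. \<Sum>q\<in>UNIV. scaleEE (\<Gamma> $ p $ q) (gE * xE p \<otimes>\<^sub>k xE q)))) \<and>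
     EE.subspace {\<chi> :: ('n, 'k) EE. infinitesimal_R_matrix (R_A A) \<chi>} \<and>
     EE.dim {\<chi> :: ('n, 'k) EE. infinitesimal_R_matrix (R_A A) \<chi>} = CARD('n) ^ 2 \<and>
     (\<forall>(\<chi> :: ('n, 'k) EE) (\<Gamma> :: 'k ^ 'n::{finite, linorder} ^ 'n::{finite, linorder}).
        \<chi> = (\<Sum>p\<in>UNIV. \<Sum>q\<in>UNIV. scaleEE (\<Gamma> $ p $ q) (gE * xE p \<otimes>\<^sub>k xE q)) \<longrightarrow>
        (cartier (R_A A) \<chi> \<longleftrightarrow> (\<forall>p q. \<Gamma> $ p $ q = - (\<Gamma> $ q $ p))))"
proof -
  have two: "(2 :: 'k) \<noteq> 0"
  proof
    assume "(2 :: 'k) = 0"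
    then have "of_nat 2 = (0 :: 'k)" by simp
    \<comment> \<open>A characteristic dividing 2 but different from 2 would be 1, which a field
      does not have.\<close>
    then have "CHAR('k) dvd 2" by (simp only: of_nat_eq_0_iff_char_dvd)
    with assms show False
      by (metis CHAR_not_1' One_nat_def prime_nat_iff two_is_prime_nat)
  qed
  obtain R' where R': "R_A A * R' = 1" "R' * R_A A = 1"
    using R_A_invertible[OF two] by blast
  have eq: "{\<chi>. infinitesimal_R_matrix (R_A A) \<chi>} = range chi_of"
    using infinitesimal_R_matrix_in_range[OF two R'] infinitesimal_chi_of[OF two R'] by blast
  then have "infinitesimal_R_matrix (R_A A) \<chi> \<longleftrightarrow> (\<exists>\<Gamma>. \<chi> = chi_of \<Gamma>)" for \<chi>
    by (auto simp: set_eq_iff image_iff)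
  then show ?thesis
    unfolding eq chi_of_def[symmetric]
    using subspace_range_chi_of dim_range_chi_of cartier_chi_of[OF two R'] by blast
qed

end
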